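(* Let $G:\Theta\times\mathbb{R}^{d}\to\mathbb{R}$ have the piecewise Hölder representation (PH) described in the context, with data $r,s_{i},G^{i},\beta_{i},C_{i},\Lambda_{il},a^{i}_{l},I_{il}$, and let $f^{i}(\theta,z):=\min_{l=1,\dots,s_{i}}\mathbf{1}_{I_{il}}\big(\Lambda_{il}(\theta,z)+a^{i}_{l}\big)$. Let $\Delta(\Theta)$ be the Euclidean diameter of $\Theta$. The mappings $f^{i}(\theta,\cdot)$ and $G^{i}(\theta,\cdot)$ are Borel measurable for all $\theta\in\Theta$ and $i\in\{1,\dots,r\}$; in particular $G(\theta,\cdot)$ is Borel measurable for every $\theta\in\Theta$. Moreover, if $\Delta(\Theta)>0$, if $G^{1}(\overline{\theta},\cdot),\dots,G^{r}(\overline{\theta},\cdot)$ are square $\mathbb{P}^{Z}$-integrable for some $\overline{\theta}\in\Theta$, and if $\xi_{1},\dots,\xi_{r}$ are bounded positive envelopes of $\mathbb{F}^{1}_{\mathrm{PH}},\dots,\mathbb{F}^{r}_{\mathrm{PH}}$ respectively, where $\mathbb{F}^{i}_{\mathrm{PH}}:=\{f^{i}(\theta,\cdot)\mid\theta\in\Theta\}$, then $$\xi:=\sum_{i=1}^{r}\xi_{i}\cdot\big(\Delta(\Theta)^{\beta_{i}}C_{i}(\cdot)+|G^{i}(\overline{\theta},\cdot)|\big)$$ is square $\mathbb{P}^{Z}$-integrable, is strictly positive with $\sup_{\theta\in\Theta}|G(\theta,z)|\le\xi(z)$ for all $z\in\mathbb{R}^{d}$, and $$J(\mathbb{F}^{\Theta},\xi,\delta)\le2\delta\sqrt{r+2rm\ln(3)+m\ln(4r/\delta)\sum_{i=1}^{r}\frac{1}{\beta_{i}}+\ln(2)+[5+2\ln(4r/\delta)](m+2)\sum_{i=1}^{r}s_{i}}$$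 for $\delta\in\,]0,1]$.
   Context: Let $m,d\in\mathbb{N}$, let $\Theta\subseteq\mathbb{R}^{m}$ be nonempty and compact, let $\mathbb{P}^{Z}$ be a probability measure on $\mathcal{B}(\mathbb{R}^{d})$ (the distribution of a $d$-dimensional random vector $Z$), and $\mathbb{F}^{\Theta}:=\{G(\theta,\cdot)\mid\theta\in\Theta\}$. $d_{m,2}$ is the Euclidean metric on $\mathbb{R}^{m}$. Condition (PH): for $\theta\in\Theta$, $z\in\mathbb{R}^{d}$, $$G(\theta,z)=\sum_{i=1}^{r}\Big(\min_{l=1,\dots,s_{i}}\mathbf{1}_{I_{il}}\big(\Lambda_{il}(\theta,z)+a^{i}_{l}\big)\Big)\cdot G^{i}(\theta,z),$$ where - $r,s_{1},\dots,s_{r}\in\mathbb{N}$; - for each $i$, $G^{i}:\Theta\times\mathbb{R}^{d}\to\mathbb{R}$ is such that $G^{i}(\theta,\cdot)$ is Borel measurable for every $\theta\in\Theta$, and there are $\beta_{i}\in\,]0,1]$ and a strictly positive square $\mathbb{P}^{Z}$-integrable $C_{i}:\mathbb{R}^{d}\to\mathbb{R}$ with $|G^{i}(\theta,z)-G^{i}(\vartheta,z)|\le C_{i}(z)\,d_{m,2}(\theta,\vartheta)^{\beta_{i}}$ for all $z\in\mathbb{R}^{d}$, $\theta,\vartheta\in\Theta$; - $\Lambda_{il}:\mathbb{R}^{m}\times\mathbb{R}^{d}\to\mathbb{R}$ is Borel measurable with $\Lambda_{il}(\cdot,z)$ affine linear for every $z\in\mathbb{R}^{d}$ ($i\in\{1,\dots,r\}$,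 $l\in\{1,\dots,s_{i}\}$); - $a^{i}_{l}\in\mathbb{R}$, and each $I_{il}$ is $]0,\infty[$ or $[0,\infty[$; - for each $\theta\in\Theta$ the sets $\bigcap_{l=1}^{s_{i}}\{z\in\mathbb{R}^{d}\mid\Lambda_{il}(\theta,z)+a^{i}_{l}\in I_{il}\}$, $i\in\{1,\dots,r\}$, form a partition of $\mathbb{R}^{d}$. For a probability measure $\mathbb{Q}$ on $\mathcal{B}(\mathbb{R}^{d})$, $\|\cdot\|_{\mathbb{Q},2}$ is the $L^{2}(\mathbb{Q})$-norm. For a nonempty set $\mathbb{F}$ of Borel measurable functions $\mathbb{R}^{d}\to\mathbb{R}$, $N(\eta,\mathbb{F},L^{2}(\mathbb{Q}))$ is the minimal number of closed $L^{2}(\mathbb{Q})$-balls of radius $\eta>0$ with centers in $\mathbb{F}$ needed to cover $\mathbb{F}$ ($\infty$ if there is no finite cover). A positive envelope of $\mathbb{F}$ is a Borel measurable $C_{\mathbb{F}}:\mathbb{R}^{d}\to\,]0,\infty[$ with $\sup_{h\in\mathbb{F}}|h|\le C_{\mathbb{F}}$. $\mathcal{M}_{\mathrm{fin}}$ is the set of probability measures on $\mathcal{B}(\mathbb{R}^{d})$ with finite support, and $$J(\mathbb{F},C_{\mathbb{F}},\delta):=\int_{0}^{\delta}\sup_{\mathbb{Q}\in\mathcal{M}_{\mathrm{fin}}}\sqrt{\ln\big(2N(\varepsilon\|C_{\mathbb{F}}\|_{\mathbb{Q},2},\mathbb{F},L^{2}(\mathbb{Q}))\big)}\,d\varepsilon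 .$$ *)

theory Defs
  imports "HOL-Probability.Probability"
begin

definition sq_integrable :: "'a measure \<Rightarrow> ('a \<Rightarrow> real) \<Rightarrow> bool" where
  "sq_integrable M h \<longleftrightarrow> h \<in> borel_measurable M \<and> integrable M (\<lambda>x. (h x)\<^sup>2)"

definition L2norm :: "'a measure \<Rightarrow> ('a \<Rightarrow> real) \<Rightarrow> real" where
  "L2norm M h = sqrt (\<integral>x. (h x)\<^sup>2 \<partial>M)"

text \<open>The integrability requirement excludes functions at infinite distance from the center:
  the Bochner integral of a non-integrable function is 0.\<close>

definition L2_cball :: "'a measure \<Rightarrow> ('a \<Rightarrow> real) \<Rightarrow> real \<Rightarrow> ('a \<Rightarrow> real) set" where
  "L2_cball M g \<eta> =
     {h. sq_integrable M (\<lambda>x. h x - g x) \<and> L2norm M (\<lambda>x. h x - g x) \<le> \<eta>}"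

text \<open>The infimum over the empty set is \<open>\<infinity>\<close>, so the value is \<open>\<infinity>\<close> if no finite cover exists.\<close>

definition covering_number :: "real \<Rightarrow> ('a \<Rightarrow> real) set \<Rightarrow> 'a measure \<Rightarrow> enat" where
  "covering_number \<eta> F Q =
     (INF K\<in>{K. finite K \<and> K \<subseteq> F \<and> F \<subseteq> (\<Union>g\<in>K. L2_cball Q g \<eta>)}. enat (card K))"

definition sqrt_ln_double :: "enat \<Rightarrow> ennreal" where
  "sqrt_ln_double N =
     (case N of enat n \<Rightarrow> ennreal (sqrt (ln (2 * real n))) | \<infinity> \<Rightarrow> \<infinity>)"

definition fin_supp_probs :: "'a::topological_space measure set" where
  "fin_supp_probs =
     {Q. prob_space Q \<and> sets Q = sets borel \<and> (\<exists>S\<in>sets Q. finite S \<and> measure Q S = 1)}"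

definition entropy_J ::
    "('a::topological_space \<Rightarrow> real) set \<Rightarrow> ('a \<Rightarrow> real) \<Rightarrow> real \<Rightarrow> ennreal" where
  "entropy_J F C \<delta> =
     (\<integral>\<^sup>+\<epsilon>\<in>{0<..\<delta>}.
        (SUP Q\<in>fin_supp_probs. sqrt_ln_double (covering_number (\<epsilon> * L2norm Q C) F Q)) \<partial>lborel)"

text \<open>The supremum is taken in the extended reals since \<open>Sup\<close> on the reals is unspecified for
  unbounded sets.\<close>

definition positive_envelope ::
    "('a::topological_space \<Rightarrow> real) set \<Rightarrow> ('a \<Rightarrow> real) \<Rightarrow> bool" where
  "positive_envelope F C \<longleftrightarrow>
     C \<in> borel_measurable borel \<and> (\<forall>z. 0 < C z) \<and>
     (\<forall>z. (SUP h\<in>F. ereal \<bar>h z\<bar>) \<le> ereal (C z))"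

definition affine_linear :: "('a::real_vector \<Rightarrow> real) \<Rightarrow> bool" where
  "affine_linear h \<longleftrightarrow> (\<exists>L c. linear L \<and> (\<forall>x. h x = L x + c))"

definition PH_f ::
    "(nat \<Rightarrow> nat) \<Rightarrow> (nat \<Rightarrow> nat \<Rightarrow> 'p \<Rightarrow> 'z \<Rightarrow> real) \<Rightarrow> (nat \<Rightarrow> nat \<Rightarrow> real) \<Rightarrow>
     (nat \<Rightarrow> nat \<Rightarrow> real set) \<Rightarrow> nat \<Rightarrow> 'p \<Rightarrow> 'z \<Rightarrow> real" where
  "PH_f s \<Lambda> a I i \<theta> z = (MIN l\<in>{1..s i}. indicator (I i l) (\<Lambda> i l \<theta> z + a i l))"

text \<open>The pieces form a partition as an indexed family; individual pieces may be empty.\<close>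

definition PH_representation ::
    "(real^'m) set \<Rightarrow> (real^'d) measure \<Rightarrow> (real^'m \<Rightarrow> real^'d \<Rightarrow> real) \<Rightarrow>
     nat \<Rightarrow> (nat \<Rightarrow> nat) \<Rightarrow> (nat \<Rightarrow> real^'m \<Rightarrow> real^'d \<Rightarrow> real) \<Rightarrow> (nat \<Rightarrow> real) \<Rightarrow>
     (nat \<Rightarrow> real^'d \<Rightarrow> real) \<Rightarrow> (nat \<Rightarrow> nat \<Rightarrow> real^'m \<Rightarrow> real^'d \<Rightarrow> real) \<Rightarrow>
     (nat \<Rightarrow> nat \<Rightarrow> real) \<Rightarrow> (nat \<Rightarrow> nat \<Rightarrow> real set) \<Rightarrow> bool" where
  "PH_representation \<Theta> PZ G r s Gi \<beta> C \<Lambda> a I \<longleftrightarrow>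
     1 \<le> r \<and> (\<forall>i\<in>{1..r}. 1 \<le> s i) \<and>
     (\<forall>\<theta>\<in>\<Theta>. \<forall>z. G \<theta> z = (\<Sum>i=1..r. PH_f s \<Lambda> a I i \<theta> z * Gi i \<theta> z)) \<and>
     (\<forall>i\<in>{1..r}.
        (\<forall>\<theta>\<in>\<Theta>. Gi i \<theta> \<in> borel_measurable borel) \<and>
        0 < \<beta> i \<and> \<beta> i \<le> 1 \<and>
        (\<forall>z. 0 < C i z) \<and> sq_integrable PZ (C i) \<and>
        (\<forall>z. \<forall>\<theta>\<in>\<Theta>. \<forall>\<theta>'\<in>\<Theta>. \<bar>Gi i \<theta> z - Gi i \<theta>' z\<bar> \<le> C i z * dist \<theta> \<theta>' powr \<beta> i)) \<and>
     (\<forall>i\<in>{1..r}. \<forall>l\<in>{1..s i}.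
        (\<lambda>(\<theta>, z). \<Lambda> i l \<theta> z) \<in> borel_measurable borel \<and>
        (\<forall>z. affine_linear (\<lambda>\<theta>. \<Lambda> i l \<theta> z)) \<and>
        I i l \<in> {{0<..}, {0..}}) \<and>
     (\<forall>\<theta>\<in>\<Theta>.
        disjoint_family_on (\<lambda>i. \<Inter>l\<in>{1..s i}. {z. \<Lambda> i l \<theta> z + a i l \<in> I i l}) {1..r} \<and>
        (\<Union>i\<in>{1..r}. \<Inter>l\<in>{1..s i}. {z. \<Lambda> i l \<theta> z + a i l \<in> I i l}) = UNIV)"

end

theory Submission
  imports Defs
begin

text \<open>For finitely supported \<open>Q\<close>, the family \<open>G(\<theta>, \<cdot>)\<close> is covered by choosing parameters such that every
  \<open>\<theta>\<close> has a chosen \<open>\<theta>'\<close> that is close in the Euclidean metric and whose signs of all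
  \<open>\<Lambda>\<^sub>i\<^sub>l + a\<^sup>i\<^sub>l\<close> agree with those of \<open>\<theta>\<close> outside a set of small measure for the probability
  proportional to \<open>\<xi>\<^sup>2 Q\<close>. Then \<open>\<bar>G(\<theta>, \<cdot>) - G(\<theta>', \<cdot>)\<bar> \<le> (1\<^sub>D + \<epsilon>/2) \<xi>\<close> with \<open>D\<close> the exceptional set.
  A volume argument bounds the number of Euclidean cells. Within a cell, sign-separated parameters
  are counted through a few greedily chosen points \<open>z\<close> that already separate them all: \<open>n\<close> affine functions
  on \<open>\<real>\<^sup>m\<close> have few sign patterns because the patterns lost by dropping one function are
  all realised on its zero set, which has smaller dimension.\<close>

section \<open>Counting sign patterns of affine functions\<close>

lemma sign_patterns_card:
  fixes g :: "'j \<Rightarrow> 'a::euclidean_space \<Rightarrow> real"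
  assumes "finite J"
    and "\<And>j. j \<in> J \<Longrightarrow> affine_linear (g j) \<and> I j \<in> {{0<..}, {0..}}"
    and "affine A" "aff_dim A \<le> int d" "0 < x" "x \<le> 1"
  shows "finite ((\<lambda>\<theta>. {j\<in>J. g j \<theta> \<in> I j}) ` A)"
    and "real (card ((\<lambda>\<theta>. {j\<in>J. g j \<theta> \<in> I j}) ` A)) * x ^ d \<le> (1 + x) ^ card J"
proof -
  show fin: "finite ((\<lambda>\<theta>. {j\<in>J. g j \<theta> \<in> I j}) ` A)"
    using assms(1) by (rule_tac finite_subset[of _ "Pow J"]) auto
  show "real (card ((\<lambda>\<theta>. {j\<in>J. g j \<theta> \<in> I j}) ` A)) * x ^ d \<le> (1 + x) ^ card J"
    using assms
  proof (induction J arbitrary: A d rule: finite_induct)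
    case empty
    have "card ((\<lambda>\<theta>. {j\<in>{}. g j \<theta> \<in> I j}) ` A) \<le> card {{}::'j set}"
      by (intro card_mono) auto
    then have "real (card ((\<lambda>\<theta>. {j\<in>{}. g j \<theta> \<in> I j}) ` A)) * x ^ d \<le> 1 * 1"
      using empty by (intro mult_mono power_le_one) auto
    then show ?case by simp
  next
    case (insert k J)
    define pat where "pat J \<theta> = {j\<in>J. g j \<theta> \<in> I j}" for J \<theta>
    define H where "H = A \<inter> {\<theta>. g k \<theta> = 0}"
    have comb: "g j (u *\<^sub>R x + v *\<^sub>R y) = u * g j x + v * g j y"
      if "j \<in> insert k J" "u + v = 1" for j u v x y
    proof -
      have "affine_linear (g j)" using insert.prems(1) that(1) by blast
      then obtain L c where L: "linear L" "\<And>\<theta>. g j \<theta> = L \<theta> + c"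
        by (auto simp: affine_linear_def)
      have "c = u * c + v * c" using that(2) by (simp flip: distrib_right)
      then show ?thesis using L by (simp add: linear_add linear_scale algebra_simps)
    qed
    have affH: "affine H"
      unfolding H_def using \<open>affine A\<close> comb[of k] by (auto simp: affine_def)
    have finJ: "finite (pat J ` B)" for B
      using \<open>finite J\<close> by (rule_tac finite_subset[of _ "Pow J"]) (auto simp: pat_def)
    define A1 where "A1 = pat J ` {\<theta>\<in>A. g k \<theta> \<in> I k}"
    define A2 where "A2 = pat J ` {\<theta>\<in>A. g k \<theta> \<notin> I k}"
    have sub: "pat (insert k J) ` A \<subseteq> insert k ` A1 \<union> A2"
      using \<open>k \<notin> J\<close> by (fastforce simp: pat_def A1_def A2_def image_iff)
    have fA: "finite A1" "finite A2" by (auto simp: A1_def A2_def finJ)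
    have "card (pat (insert k J) ` A) \<le> card (insert k ` A1) + card A2"
      using card_mono[OF _ sub] fA card_Un_le[of "insert k ` A1" A2] by fastforce
    also have "\<dots> \<le> card A1 + card A2" using fA by (simp add: card_image_le)
    \<comment> \<open>Patterns in the intersection are those that \<open>g k\<close> splits in two;
      only they add to the count for \<open>J\<close>.\<close>
    also have "\<dots> = card (A1 \<union> A2) + card (A1 \<inter> A2)" using fA by (rule card_Un_Int)
    also have "A1 \<union> A2 = pat J ` A" by (auto simp: A1_def A2_def)
    finally have c1: "card (pat (insert k J) ` A) \<le> card (pat J ` A) + card (A1 \<inter> A2)" .
    \<comment> \<open>If one pattern occurs on both sides of \<open>g k\<close>, then the segment
      between the two parameters meets the zero set of \<open>g k\<close>. The other conditions keep
      their truth value along the segment, since each half-line \<open>I j\<close> and its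
      complement are convex.\<close>
    have cross: "\<exists>\<eta>\<in>H. pat J \<eta> = pat J \<theta>"
      if "\<theta> \<in> A" "\<theta>' \<in> A" "g k \<theta> \<in> I k" "g k \<theta>' \<notin> I k" "pat J \<theta> = pat J \<theta>'" for \<theta> \<theta>'
    proof -
      have pos: "g k \<theta> \<ge> 0" "g k \<theta>' \<le> 0" "g k \<theta> - g k \<theta>' > 0"
        using insert.prems(1)[of k] that by auto
      define u where "u = g k \<theta> / (g k \<theta> - g k \<theta>')"
      have u: "0 \<le> u" "u \<le> 1" using pos by (auto simp: u_def)
      define \<eta> where "\<eta> = (1 - u) *\<^sub>R \<theta> + u *\<^sub>R \<theta>'"
      have "g k \<eta> = 0"
      proof -
        have "g k \<eta> = g k \<theta> - u * (g k \<theta> - g k \<theta>')"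
          unfolding \<eta>_def using comb[of k "1-u" u \<theta> \<theta>'] by (simp add: algebra_simps)
        then show ?thesis using pos by (simp add: u_def)
      qed
      moreover have "\<eta> \<in> A" unfolding \<eta>_def using \<open>affine A\<close> that by (auto simp: affine_def)
      moreover have "g j \<eta> \<in> I j \<longleftrightarrow> g j \<theta> \<in> I j" if j: "j \<in> J" for j
      proof -
        have e: "g j \<eta> = (1 - u) * g j \<theta> + u * g j \<theta>'"
          unfolding \<eta>_def using comb[of j "1-u" u] j by auto
        have same: "g j \<theta> \<in> I j \<longleftrightarrow> g j \<theta>' \<in> I j"
          using \<open>pat J \<theta> = pat J \<theta>'\<close> j by (auto simp: pat_def)
        have "- {0<..} = {..0::real}" "- {0..} = {..<0::real}" by auto
        moreover have "I j = {0<..} \<or> I j = {0..}" using insert.prems(1)[of j] j by blast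
        ultimately have cI: "convex (I j)" "convex (- I j)" by fastforce+
        show ?thesis
          using convexD[OF cI(1), of "g j \<theta>" "g j \<theta>'" "1-u" u]
            convexD[OF cI(2), of "g j \<theta>" "g j \<theta>'" "1-u" u] same u e by auto
      qed
      ultimately show ?thesis by (auto simp: H_def pat_def intro!: bexI[of _ \<eta>])
    qed
    have sub2: "A1 \<inter> A2 \<subseteq> pat J ` H"
    proof
      fix p assume "p \<in> A1 \<inter> A2"
      then obtain \<theta> \<theta>' where "\<theta> \<in> A" "\<theta>' \<in> A" "g k \<theta> \<in> I k" "g k \<theta>' \<notin> I k" "p = pat J \<theta>" "p = pat J \<theta>'"
        by (auto simp: A1_def A2_def)
      with cross[of \<theta> \<theta>'] show "p \<in> pat J ` H" by (metis image_eqI)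
    qed
    have IH1: "real (card (pat J ` A)) * x ^ d \<le> (1 + x) ^ card J"
      unfolding pat_def using insert by auto
    have IH2: "real (card (A1 \<inter> A2)) * x ^ d \<le> x * (1 + x) ^ card J"
    proof (cases "A1 \<inter> A2 = {}")
      case True then show ?thesis using \<open>0 < x\<close> by simp
    next
      case False
      then obtain \<theta> \<theta>' where t: "\<theta> \<in> A" "\<theta>' \<in> A" "g k \<theta> \<in> I k" "g k \<theta>' \<notin> I k"
        by (auto simp: A1_def A2_def)
      \<comment> \<open>Since 0 either belongs to \<open>I k\<close> or does not, points on opposite
        sides cannot both be zeros of \<open>g k\<close>. Hence \<open>H\<close> is a proper affine
        subset of \<open>A\<close> and its dimension is strictly smaller.\<close>
      then have "g k \<theta> \<noteq> 0 \<or> g k \<theta>' \<noteq> 0" by metis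
      then have "H \<subset> A" using t(1,2) unfolding H_def by blast
      then have "aff_dim H < aff_dim A"
        using affH \<open>affine A\<close> by (intro aff_dim_psubset) (simp add: hull_same)
      moreover have "H \<noteq> {}" using False sub2 by auto
      then have "aff_dim H \<ge> 0"
        using aff_dim_negative_iff[of H] by linarith
      \<comment> \<open>Nonemptiness of \<open>H\<close> excludes \<open>d = 0\<close>, so one
        factor \<open>x\<close> can be split off from \<open>x ^ d\<close>.\<close>
      ultimately obtain e where e: "d = Suc e" "aff_dim H \<le> int e"
        using \<open>aff_dim A \<le> int d\<close> by (cases d) auto
      have "real (card (A1 \<inter> A2)) * x ^ d \<le> x * (real (card (pat J ` H)) * x ^ e)"
        using \<open>0 < x\<close> e card_mono[OF finJ sub2] by (simp add: mult_right_mono)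
      also have "\<dots> \<le> x * (1 + x) ^ card J"
        unfolding pat_def using insert.IH[OF _ affH e(2)] insert.prems by (intro mult_left_mono) auto
      finally show ?thesis .
    qed
    have "real (card (pat (insert k J) ` A)) * x ^ d
        \<le> (real (card (pat J ` A)) + real (card (A1 \<inter> A2))) * x ^ d"
      using c1 \<open>0 < x\<close> by (intro mult_right_mono) auto
    also have "\<dots> \<le> (1 + x) ^ card J + x * (1 + x) ^ card J"
      using IH1 IH2 by (simp add: distrib_right)
    also have "\<dots> = (1 + x) ^ card (insert k J)" using insert.hyps by (simp add: distrib_right)
    finally show ?case by (simp add: pat_def)
  qed
qed

text \<open>Averaging: each remaining \<open>p\<close> is hit by points of total weight at least
  \<kappa>, so some single point hits at least the fraction \<kappa> of the remaining
  \<open>p\<close>. Each greedy round therefore multiplies the number of survivors by at most 1 -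
  \<kappa>.\<close>

lemma greedy_hitting_set:
  fixes w :: "'z \<Rightarrow> real" and \<kappa> :: real
  assumes "finite Z" "\<And>z. z \<in> Z \<Longrightarrow> 0 \<le> w z" "sum w Z = 1"
    and "finite P" "\<kappa> \<le> 1"
    and "\<And>p. p \<in> P \<Longrightarrow> \<kappa> \<le> (\<Sum>z | z \<in> Z \<and> R p z. w z)"
  shows "\<exists>X\<subseteq>Z. card X \<le> n \<and> real (card {p\<in>P. \<forall>z\<in>X. \<not> R p z}) \<le> (1 - \<kappa>) ^ n * card P"
proof (induction n)
  case 0
  show ?case by (intro exI[of _ "{}"]) simp
next
  case (Suc n)
  then obtain X where X: "X \<subseteq> Z" "card X \<le> n"
    "real (card {p\<in>P. \<forall>z\<in>X. \<not> R p z}) \<le> (1 - \<kappa>) ^ n * card P" by blast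
  define U where "U = {p\<in>P. \<forall>z\<in>X. \<not> R p z}"
  have fU: "finite U" using \<open>finite P\<close> by (auto simp: U_def)
  have "\<exists>z\<in>Z. real (card {p\<in>U. R p z}) \<ge> \<kappa> * card U"
  proof (rule ccontr)
    assume "\<not> ?thesis"
    then have lt: "\<And>z. z \<in> Z \<Longrightarrow> real (card {p\<in>U. R p z}) < \<kappa> * card U" by auto
    have "\<kappa> * card U = (\<Sum>p\<in>U. \<kappa>)" by simp
    also have "\<dots> \<le> (\<Sum>p\<in>U. \<Sum>z | z \<in> Z \<and> R p z. w z)"
      using assms(6) by (intro sum_mono) (auto simp: U_def)
    also have "\<dots> = (\<Sum>p\<in>U. \<Sum>z\<in>Z. if R p z then w z else 0)"
      using \<open>finite Z\<close> by (simp add: sum.inter_filter)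
    also have "\<dots> = (\<Sum>z\<in>Z. \<Sum>p\<in>U. if R p z then w z else 0)" by (rule sum.swap)
    also have "\<dots> = (\<Sum>z\<in>Z. w z * card {p\<in>U. R p z})"
      using fU by (simp add: mult.commute flip: sum.inter_filter)
    finally have 1: "\<kappa> * card U \<le> (\<Sum>z\<in>Z. w z * card {p\<in>U. R p z})" .
    \<comment> \<open>A point of positive weight is what makes the averaged inequality
      strict.\<close>
    have "\<exists>z\<in>Z. 0 < w z"
      using assms(2,3) sum_nonpos[of Z w] by force
    then obtain z where z: "z \<in> Z" "0 < w z" by auto
    have "(\<Sum>z\<in>Z. w z * card {p\<in>U. R p z}) < (\<Sum>z\<in>Z. w z * (\<kappa> * card U))"
      using z lt assms(1,2)
      by (intro sum_strict_mono_ex1) (auto intro!: mult_left_mono bexI[of _ z] intro: less_imp_le)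
    also have "\<dots> = \<kappa> * card U" using assms(3) by (simp flip: sum_distrib_right)
    finally show False using 1 by simp
  qed
  then obtain z where z: "z \<in> Z" "real (card {p\<in>U. R p z}) \<ge> \<kappa> * card U" by auto
  have "{p\<in>P. \<forall>z\<in>insert z X. \<not> R p z} = U - {p\<in>U. R p z}" by (auto simp: U_def)
  then have "real (card {p\<in>P. \<forall>z\<in>insert z X. \<not> R p z}) = real (card U) - card {p\<in>U. R p z}"
    using fU by (simp add: card_Diff_subset card_mono of_nat_diff)
  also have "\<dots> \<le> (1 - \<kappa>) * card U" using z by (simp add: algebra_simps)
  also have "\<dots> \<le> (1 - \<kappa>) * ((1 - \<kappa>) ^ n * card P)"
    using X \<open>\<kappa> \<le> 1\<close> by (intro mult_left_mono) (auto simp: U_def)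
  finally show ?case
    using X z finite_subset[OF X(1) assms(1)]
    by (intro exI[of _ "insert z X"]) (auto simp: card_insert_if mult_ac)
qed

text \<open>Greedily chosen points \<open>X\<close>, about \<open>2 ln N / \<kappa>\<close> many, separate all \<open>N\<close> parameters, so \<open>N\<close> is
  at most the number of sign patterns of \<open>card J * card X\<close> affine functions; the choice
  \<open>x = \<kappa> / (4 card J)\<close> in the pattern count leaves half of \<open>ln N\<close> on the right.\<close>

lemma separated_sign_patterns_card:
  fixes g :: "'j \<Rightarrow> 'z \<Rightarrow> 'a::euclidean_space \<Rightarrow> real" and w :: "'z \<Rightarrow> real" and \<kappa> :: real
  assumes "finite J" "J \<noteq> {}"
    and aff: "\<And>j z. j \<in> J \<Longrightarrow> affine_linear (g j z) \<and> I j \<in> {{0<..}, {0..}}"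
    and "finite Z" "\<And>z. z \<in> Z \<Longrightarrow> 0 \<le> w z" "sum w Z = 1"
    and "0 < \<kappa>" "\<kappa> \<le> 1" "finite T"
    and sep: "\<And>\<theta> \<theta>'. \<theta> \<in> T \<Longrightarrow> \<theta>' \<in> T \<Longrightarrow> \<theta> \<noteq> \<theta>' \<Longrightarrow>
       \<kappa> \<le> (\<Sum>z | z \<in> Z \<and> (\<exists>j\<in>J. (g j z \<theta> \<in> I j) \<noteq> (g j z \<theta>' \<in> I j)). w z)"
  shows "real (card T) \<le> exp (1/2) * (4 * card J / \<kappa>) ^ (2 * DIM('a))"
proof (cases "T = {}")
  case True then show ?thesis using \<open>0 < \<kappa>\<close> by simp
next
  case False
  define N where "N = real (card T)"
  have N: "N \<ge> 1" using False \<open>finite T\<close> by (simp add: N_def Suc_leI card_gt_0_iff)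
  define P where "P = T \<times> T - Id"
  have fP: "finite P" using \<open>finite T\<close> by (simp add: P_def)
  have "P \<subset> T \<times> T" using False by (auto simp: P_def)
  then have "card P < card (T \<times> T)" using \<open>finite T\<close> by (intro psubset_card_mono) auto
  \<comment> \<open>Removing the diagonal makes this strict, which later brings the number of
    unseparated pairs strictly below 1.\<close>
  then have cP: "real (card P) < N ^ 2"
    by (simp add: N_def card_cartesian_product power2_eq_square flip: of_nat_mult)
  \<comment> \<open>With this many rounds, (1 - \<kappa>)^n <= exp(-\<kappa> n) <= 1 / N^2, which
    beats the number of pairs. So no pair is left unseparated.\<close>
  define n where "n = nat \<lceil>2 * ln N / \<kappa>\<rceil>"
  have n0: "2 * ln N / \<kappa> \<ge> 0" using N \<open>0 < \<kappa>\<close> by simp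
  have n: "2 * ln N / \<kappa> \<le> n" "n \<le> 2 * ln N / \<kappa> + 1"
    unfolding n_def using n0 by linarith+
  define R where "R p z \<longleftrightarrow> (\<exists>j\<in>J. (g j z (fst p) \<in> I j) \<noteq> (g j z (snd p) \<in> I j))" for p z
  obtain X where X: "X \<subseteq> Z" "card X \<le> n" 
    "real (card {p\<in>P. \<forall>z\<in>X. \<not> R p z}) \<le> (1 - \<kappa>) ^ n * card P"
    using greedy_hitting_set[of Z w P \<kappa> R n] assms sep fP by (force simp: P_def R_def)
  have "(1 - \<kappa>) ^ n \<le> exp (- \<kappa>) ^ n"
    using \<open>\<kappa> \<le> 1\<close> exp_ge_add_one_self[of "-\<kappa>"] by (intro power_mono) auto
  also have "\<dots> = exp (- (\<kappa> * n))" by (simp flip: exp_of_nat_mult add: mult_ac)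
  also have "\<dots> \<le> exp (- (2 * ln N))" using n(1) \<open>0 < \<kappa>\<close> by (simp add: field_simps)
  also have "\<dots> = 1 / N ^ 2" using N by (simp add: exp_minus exp_double ln_div divide_inverse)
  finally have "(1 - \<kappa>) ^ n * card P \<le> 1 / N ^ 2 * card P" by (rule mult_right_mono) simp
  also have "\<dots> < 1" using cP N by (simp add: field_simps)
  finally have "card {p\<in>P. \<forall>z\<in>X. \<not> R p z} = 0" using X(3) by linarith
  then have hit: "\<And>p. p \<in> P \<Longrightarrow> \<exists>z\<in>X. R p z" using fP by auto
  define pat where "pat \<theta> = {q \<in> J \<times> X. (\<lambda>(j, z). g j z) q \<theta> \<in> (\<lambda>(j, z). I j) q}" for \<theta>
  have "inj_on pat T"
  proof (rule inj_onI, rule ccontr)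
    fix \<theta> \<theta>' assume t: "\<theta> \<in> T" "\<theta>' \<in> T" "pat \<theta> = pat \<theta>'" "\<theta> \<noteq> \<theta>'"
    then obtain z j where "z \<in> X" "j \<in> J" "(g j z \<theta> \<in> I j) \<noteq> (g j z \<theta>' \<in> I j)"
      using hit[of "(\<theta>, \<theta>')"] by (auto simp: P_def R_def)
    then have "((j, z) \<in> pat \<theta>) \<noteq> ((j, z) \<in> pat \<theta>')" by (auto simp: pat_def)
    then show False using t by simp
  qed
  have fX: "finite X" using X \<open>finite Z\<close> finite_subset by auto
  define x where "x = \<kappa> / (4 * card J)"
  have cJ: "real (card J) \<ge> 1" using assms(1,2) by (simp add: Suc_leI card_gt_0_iff)
  have x: "0 < x" "x \<le> 1" using cJ \<open>0 < \<kappa>\<close> \<open>\<kappa> \<le> 1\<close> by (auto simp: x_def field_simps)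
  note sp = sign_patterns_card[of "J \<times> X" "\<lambda>(j, z). g j z" "\<lambda>(j, z). I j" UNIV "DIM('a)" x]
  have fin: "finite (range pat)" unfolding pat_def
    by (rule sp(1)) (use assms fX x in \<open>auto simp: aff\<close>)
  have "real (card (range pat)) * x ^ DIM('a) \<le> (1 + x) ^ card (J \<times> X)" unfolding pat_def
    by (rule sp(2)) (use assms fX x in \<open>auto simp: aff\<close>)
  moreover have "N \<le> real (card (range pat))"
    using card_image[OF \<open>inj_on pat T\<close>] card_mono[OF fin, of "pat ` T"] by (auto simp: N_def)
  ultimately have "N * x ^ DIM('a) \<le> (1 + x) ^ card (J \<times> X)"
    using x by (meson mult_right_mono order_trans zero_le_power less_imp_le)
  also have "\<dots> \<le> exp x ^ card (J \<times> X)"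
    using x exp_ge_add_one_self[of x] by (intro power_mono) auto
  also have "\<dots> = exp (x * (card J * card X))"
    by (simp flip: exp_of_nat_mult add: mult_ac card_cartesian_product)
  also have "x * (card J * card X) = \<kappa> / 4 * card X" using cJ by (simp add: x_def)
  \<comment> \<open>Rounding \<open>n\<close> up costs at most 1, hence the additional 1/4 in the
    exponent and, after squaring, the factor \<open>exp (1/2)\<close>.\<close>
  also have "\<dots> \<le> \<kappa> / 4 * (2 * ln N / \<kappa> + 1)"
    using X(2) n(2) \<open>0 < \<kappa>\<close> by (intro mult_left_mono) auto
  also have "\<dots> \<le> ln N / 2 + 1 / 4" using \<open>0 < \<kappa>\<close> \<open>\<kappa> \<le> 1\<close> by (simp add: field_simps)
  finally have "N * x ^ DIM('a) \<le> exp (ln N / 2 + 1 / 4)" by simp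
  \<comment> \<open>The right side grows like the square root of \<open>N\<close>. Squaring makes it
    proportional to \<open>N\<close>, so one of the two factors \<open>N\<close> on the left
    cancels; this doubles the exponent to \<open>2 * DIM('a)\<close>.\<close>
  then have "(N * x ^ DIM('a)) ^ 2 \<le> exp (ln N / 2 + 1 / 4) ^ 2"
    using N x by (intro power_mono) auto
  also have "\<dots> = exp (ln N + 1 / 2)" by (simp flip: exp_double)
  also have "\<dots> = N * exp (1/2)" using N by (simp add: exp_add)
  finally have "N * (N * x ^ (2 * DIM('a))) \<le> N * exp (1/2)"
    by (simp add: power2_eq_square power_mult_distrib mult_ac flip: power_mult power_add)
      (simp add: power2_eq_square mult_2_right power_add mult_ac)
  then have "N * x ^ (2 * DIM('a)) \<le> exp (1/2)" using N by simp
  then have "N \<le> exp (1/2) / x ^ (2 * DIM('a))" using x by (simp add: pos_le_divide_eq)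
  also have "\<dots> = exp (1/2) * (1 / x) ^ (2 * DIM('a))" by (simp add: power_divide)
  also have "1 / x = 4 * card J / \<kappa>" by (simp add: x_def)
  finally show ?thesis by (simp add: N_def)
qed

section \<open>Nets from maximal separated sets\<close>

text \<open>The uniform bound provides a separated set of greatest cardinality. A point unrelated to
  all its elements could be added to it, so it is already a net. The relation is abstract because
  the lemma serves both for Euclidean closeness and for closeness combined with nearly equal
  signs.\<close>

lemma maximal_separated_net:
  fixes R :: "'a \<Rightarrow> 'a \<Rightarrow> bool" and N :: real
  assumes refl: "\<And>x. x \<in> A \<Longrightarrow> R x x" and sym: "\<And>x y. R x y \<Longrightarrow> R y x"
    and bound: "\<And>K. finite K \<Longrightarrow> K \<subseteq> A \<Longrightarrow> pairwise (\<lambda>x y. \<not> R x y) K \<Longrightarrow> real (card K) \<le> N"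
  shows "\<exists>K. finite K \<and> K \<subseteq> A \<and> real (card K) \<le> N \<and> (\<forall>x\<in>A. \<exists>y\<in>K. R x y)"
proof -
  define P where "P K \<longleftrightarrow> finite K \<and> K \<subseteq> A \<and> pairwise (\<lambda>x y. \<not> R x y) K" for K
  have "P {}" by (simp add: P_def)
  moreover have "\<forall>K. P K \<longrightarrow> card K < Suc (nat \<lfloor>N\<rfloor>)"
    using bound by (auto simp: P_def le_nat_floor less_Suc_eq_le)
  ultimately have "\<exists>K. P K \<and> (\<forall>K'. P K' \<longrightarrow> card K' \<le> card K)"
    by (rule ex_has_greatest_nat)
  then obtain K where K: "P K" "\<And>K'. P K' \<Longrightarrow> card K' \<le> card K" by blast
  have "\<exists>y\<in>K. R x y" if "x \<in> A" for x
  proof (rule ccontr)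
    assume no: "\<not> ?thesis"
    then have "x \<notin> K" using refl that by blast
    have "P (insert x K)"
      using K(1) that no sym by (auto simp: P_def pairwise_insert)
    then show False using K(2)[of "insert x K"] K(1) \<open>x \<notin> K\<close> by (simp add: P_def)
  qed
  then show ?thesis using K(1) bound by (auto simp: P_def)
qed

text \<open>Volume comparison: the balls of radius \<rho>/2 around the points are disjoint and lie
  in the ball of radius \<open>diameter X + \<rho>/2\<close> around any one of them.\<close>

lemma separated_set_card:
  fixes X :: "'a::euclidean_space set"
  assumes "bounded X" "0 < \<rho>" "finite T" "T \<subseteq> X"
    and sep: "pairwise (\<lambda>x y. \<rho> < dist x y) T"
  shows "real (card T) \<le> (1 + 2 * diameter X / \<rho>) ^ DIM('a)"
proof (cases "T = {}")
  case True
  then show ?thesis using diameter_ge_0[OF assms(1)] \<open>0 < \<rho>\<close> by simp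
next
  case False
  then obtain t0 where t0: "t0 \<in> T" by auto
  define D where "D = diameter X"
  have D: "D \<ge> 0" using diameter_ge_0[OF assms(1)] by (simp add: D_def)
  have disj: "disjoint_family_on (\<lambda>t. ball t (\<rho>/2)) T"
  proof (unfold disjoint_family_on_def, intro ballI impI)
    fix s t assume "s \<in> T" "t \<in> T" "s \<noteq> t"
    then have "\<rho> < dist s t" using sep by (auto simp: pairwise_def)
    then show "ball s (\<rho>/2) \<inter> ball t (\<rho>/2) = {}" by (intro disjoint_ballI) auto
  qed
  have sub: "(\<Union>t\<in>T. ball t (\<rho>/2)) \<subseteq> ball t0 (D + \<rho>/2)"
  proof clarify
    fix t y assume ty: "t \<in> T" "y \<in> ball t (\<rho>/2)"
    have "dist t0 t \<le> D"
      unfolding D_def using assms(1,4) t0 ty by (intro diameter_bounded_bound) auto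
    then show "y \<in> ball t0 (D + \<rho>/2)" using ty dist_triangle[of t0 y t] by simp
  qed
  have "real (card T) * (unit_ball_vol (DIM('a)) * (\<rho>/2) ^ DIM('a)) = (\<Sum>t\<in>T. measure lborel (ball t (\<rho>/2)))"
    using \<open>0 < \<rho>\<close> by (simp add: content_ball)
  also have "\<dots> = measure lborel (\<Union>t\<in>T. ball t (\<rho>/2))"
    using disj \<open>finite T\<close> emeasure_lborel_ball_finite
    by (intro measure_finite_Union[symmetric]) (auto simp: less_top[symmetric])
  also have "\<dots> \<le> measure lborel (ball t0 (D + \<rho>/2))"
    using sub emeasure_lborel_ball_finite \<open>finite T\<close>
    by (intro measure_mono_fmeasurable) (auto simp: fmeasurable_def)
  also have "\<dots> = unit_ball_vol (DIM('a)) * (D + \<rho>/2) ^ DIM('a)"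
    using D \<open>0 < \<rho>\<close> by (simp add: content_ball)
  finally have "real (card T) * (\<rho>/2) ^ DIM('a) \<le> (D + \<rho>/2) ^ DIM('a)"
    using unit_ball_vol_pos[of "DIM('a)"] by (simp add: mult.left_commute)
  then have "real (card T) \<le> (D + \<rho>/2) ^ DIM('a) / (\<rho>/2) ^ DIM('a)"
    using \<open>0 < \<rho>\<close> by (simp add: pos_le_divide_eq)
  also have "\<dots> = (1 + 2 * D / \<rho>) ^ DIM('a)"
    using \<open>0 < \<rho>\<close> by (simp add: add_divide_distrib mult.commute add.commute flip: power_divide)
  finally show ?thesis by (simp add: D_def)
qed

text \<open>Two nets are nested. A Euclidean net splits \<open>X\<close> into at most
  \<open>(5 / t) ^ DIM('a)\<close> cells. A set separated for the combined relation has, within one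
  cell, only sign-separated points, and \<open>separated_sign_patterns_card\<close> counts
  those.\<close>

lemma sign_pattern_net:
  fixes g :: "'j \<Rightarrow> 'z \<Rightarrow> 'a::euclidean_space \<Rightarrow> real" and w :: "'z \<Rightarrow> real" and \<kappa> t :: real
  assumes J: "finite J" "J \<noteq> {}"
    and aff: "\<And>j z. j \<in> J \<Longrightarrow> affine_linear (g j z) \<and> I j \<in> {{0<..}, {0..}}"
    and Z: "finite Z" "\<And>z. z \<in> Z \<Longrightarrow> 0 \<le> w z" "sum w Z = 1"
    and \<kappa>: "0 < \<kappa>" "\<kappa> \<le> 1" and t: "0 < t" "t \<le> 1"
    and X: "bounded X" "0 < diameter X"
  shows "\<exists>K. finite K \<and> K \<subseteq> X \<and>
    real (card K) \<le> (5 / t) ^ DIM('a) * (exp (1/2) * (4 * card J / \<kappa>) ^ (2 * DIM('a))) \<and>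
    (\<forall>\<theta>\<in>X. \<exists>\<theta>'\<in>K. dist \<theta> \<theta>' \<le> diameter X * t \<and>
      (\<Sum>z | z \<in> Z \<and> (\<exists>j\<in>J. (g j z \<theta> \<in> I j) \<noteq> (g j z \<theta>' \<in> I j)). w z) < \<kappa>)"
proof -
  define S where "S \<theta> \<theta>' = (\<Sum>z | z \<in> Z \<and> (\<exists>j\<in>J. (g j z \<theta> \<in> I j) \<noteq> (g j z \<theta>' \<in> I j)). w z)" for \<theta> \<theta>'
  define B where "B = exp (1/2) * (4 * card J / \<kappa>) ^ (2 * DIM('a))"
  have S_sym: "S x y = S y x" for x y
    unfolding S_def by (rule arg_cong[of _ _ "sum w"]) blast
  have S_refl: "S x x = 0" for x by (simp add: S_def)
  \<comment> \<open>Half the target distance, so that two points of one cell are within the full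
    target distance of each other.\<close>
  define \<rho> where "\<rho> = diameter X * t / 2"
  have \<rho>: "0 < \<rho>" using t X by (simp add: \<rho>_def)
  have "\<exists>T. finite T \<and> T \<subseteq> X \<and> real (card T) \<le> (5 / t) ^ DIM('a) \<and> (\<forall>x\<in>X. \<exists>y\<in>T. dist x y \<le> \<rho>)"
  proof (rule maximal_separated_net)
    fix K assume K: "finite K" "K \<subseteq> X" "pairwise (\<lambda>x y. \<not> dist x y \<le> \<rho>) K"
    have "real (card K) \<le> (1 + 2 * diameter X / \<rho>) ^ DIM('a)"
      using K X(1) \<rho> by (intro separated_set_card) (auto simp: not_le)
    also have "1 + 2 * diameter X / \<rho> = 1 + 4 / t" using X t by (simp add: \<rho>_def field_simps)
    also have "(1 + 4 / t) ^ DIM('a) \<le> (5 / t) ^ DIM('a)"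
      using t by (intro power_mono) (auto simp: field_simps)
    finally show "real (card K) \<le> (5 / t) ^ DIM('a)" .
  qed (use \<rho> in \<open>auto simp: dist_commute\<close>)
  then obtain T where T: "finite T" "T \<subseteq> X" "real (card T) \<le> (5 / t) ^ DIM('a)"
    "\<And>x. x \<in> X \<Longrightarrow> \<exists>y\<in>T. dist x y \<le> \<rho>" by blast
  have "\<exists>K. finite K \<and> K \<subseteq> X \<and> real (card K) \<le> (5 / t) ^ DIM('a) * B \<and>
    (\<forall>x\<in>X. \<exists>y\<in>K. dist x y \<le> diameter X * t \<and> S x y < \<kappa>)"
  proof (rule maximal_separated_net)
    fix K assume K: "finite K" "K \<subseteq> X" "pairwise (\<lambda>x y. \<not> (dist x y \<le> diameter X * t \<and> S x y < \<kappa>)) K"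
    have cell: "real (card {x\<in>K. dist x y \<le> \<rho>}) \<le> B" for y
      unfolding B_def
    proof (rule separated_sign_patterns_card[OF J aff Z \<kappa>])
      fix a b assume ab: "a \<in> {x\<in>K. dist x y \<le> \<rho>}" "b \<in> {x\<in>K. dist x y \<le> \<rho>}" "a \<noteq> b"
      have "dist a b \<le> dist a y + dist b y" by (rule dist_triangle2)
      also have "\<dots> \<le> diameter X * t" using ab by (simp add: \<rho>_def)
      \<comment> \<open>The points are metrically close, so their separation in \<open>K\<close>
        must come from the signs.\<close>
      finally show "\<kappa> \<le> (\<Sum>z | z \<in> Z \<and> (\<exists>j\<in>J. (g j z a \<in> I j) \<noteq> (g j z b \<in> I j)). w z)"
        using K(3) ab unfolding pairwise_def S_def by fastforce
    qed (use K in auto)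
    have "K = (\<Union>y\<in>T. {x\<in>K. dist x y \<le> \<rho>})" using K T by blast
    then have "real (card K) \<le> (\<Sum>y\<in>T. real (card {x\<in>K. dist x y \<le> \<rho>}))"
      using card_UN_le[OF T(1), of "\<lambda>y. {x\<in>K. dist x y \<le> \<rho>}"] by (simp flip: of_nat_sum)
    also have "\<dots> \<le> (\<Sum>y\<in>T. B)" by (intro sum_mono cell)
    also have "\<dots> = real (card T) * B" by simp
    also have "\<dots> \<le> (5 / t) ^ DIM('a) * B"
      using T(3) \<kappa> by (intro mult_right_mono) (auto simp: B_def)
    finally show "real (card K) \<le> (5 / t) ^ DIM('a) * B" .
  qed (use X t \<kappa> S_sym S_refl in \<open>auto simp: dist_commute\<close>)
  then show ?thesis unfolding S_def B_def .
qed

section \<open>The entropy integral\<close>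

text \<open>Jensen's inequality for the square root, carried out with a tangent: the mean of A - B
  ln \<epsilon> over the interval up to \<delta> is A + B - B ln \<delta> = c^2, and sqrt y <= y /
  (2c) + c / 2. The majorant \<open>f\<close> has the explicit primitive \<open>F\<close>, with
  \<open>F \<delta> = \<delta> * c\<close>.\<close>

lemma nn_integral_sqrt_ln_le:
  fixes A B \<delta> :: real
  assumes "0 < A" "0 \<le> B" "0 < \<delta>" "\<delta> \<le> 1"
  shows "(\<integral>\<^sup>+\<epsilon>\<in>{0<..\<delta>}. ennreal (sqrt (A - B * ln \<epsilon>)) \<partial>lborel) \<le> ennreal (\<delta> * sqrt (A + B - B * ln \<delta>))"
proof -
  define c where "c = sqrt (A + B - B * ln \<delta>)"
  have lnneg: "B * ln \<epsilon> \<le> 0" if "0 < \<epsilon>" "\<epsilon> \<le> 1" for \<epsilon>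
    using that assms by (simp add: mult_nonneg_nonpos)
  have rad: "A + B - B * ln \<delta> > 0" using assms lnneg[of \<delta>] by linarith
  then have c: "c > 0" "c\<^sup>2 = A + B - B * ln \<delta>" by (simp_all add: c_def)
  define f where "f \<epsilon> = (A - B * ln \<epsilon>) / (2 * c) + c / 2" for \<epsilon>
  define F where "F \<epsilon> = ((A + B) * \<epsilon> - B * (\<epsilon> * ln \<epsilon>)) / (2 * c) + c * \<epsilon> / 2" for \<epsilon>
  have dF: "(F has_real_derivative f \<epsilon>) (at \<epsilon>)" if "0 < \<epsilon>" for \<epsilon>
    unfolding F_def f_def using that c(1)
    by (auto intro!: derivative_eq_intros simp: field_simps)
  have f0: "0 \<le> f \<epsilon>" if "0 < \<epsilon>" "\<epsilon> \<le> \<delta>" for \<epsilon>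
    using that assms c lnneg[of \<epsilon>] by (auto simp: f_def)
  \<comment> \<open>For \<open>B > 0\<close> the majorant is unbounded at 0, so the fundamental
    theorem is applied with one-sided limits of \<open>F\<close>.\<close>
  have "((\<lambda>\<epsilon>::real. \<epsilon> * ln \<epsilon>) \<longlongrightarrow> 0) (at_right 0)" by real_asymp
  then have "(F \<longlongrightarrow> ((A + B) * 0 - B * 0) / (2 * c) + c * 0 / 2) (at_right 0)"
    unfolding F_def using c(1) by (intro tendsto_intros) auto
  then have lim0: "((F \<circ> real_of_ereal) \<longlongrightarrow> 0) (at_right (ereal 0))"
    by (simp add: ereal_tendsto_simps)
  have "isCont F \<delta>" using dF assms(3) DERIV_isCont by blast
  then have "(F \<longlongrightarrow> F \<delta>) (at_left \<delta>)" by (simp add: isCont_def filterlim_at_split)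
  then have lim1: "((F \<circ> real_of_ereal) \<longlongrightarrow> F \<delta>) (at_left (ereal \<delta>))"
    by (simp add: ereal_tendsto_simps)
  have fcont: "isCont f \<epsilon>" if "0 < \<epsilon>" for \<epsilon>
    unfolding f_def using that c(1) by (intro continuous_intros) auto
  have ei: "einterval (ereal 0) (ereal \<delta>) = {0<..<\<delta>}" by (auto simp: einterval_def)
  have "ereal 0 < ereal \<delta>" using assms by simp
  note FTC = interval_integral_FTC_nonneg[OF this _ _ _ lim0 lim1, of f]
  have int: "set_integrable lborel {0<..<\<delta>} f" "(LBINT \<epsilon>=ereal 0..ereal \<delta>. f \<epsilon>) = F \<delta>"
    using FTC[unfolded ei] dF fcont f0 by auto
  have c_eq: "F \<delta> = \<delta> * c"
  proof -
    have "F \<delta> = \<delta> * c\<^sup>2 / (2 * c) + c * \<delta> / 2" unfolding c(2) by (simp add: F_def algebra_simps)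
    also have "\<dots> = \<delta> * c" using c(1) by (simp add: power2_eq_square)
    finally show ?thesis .
  qed
  have le: "sqrt (A - B * ln \<epsilon>) \<le> f \<epsilon>" if "0 < \<epsilon>" "\<epsilon> \<le> \<delta>" for \<epsilon>
  proof -
    have nn: "A - B * ln \<epsilon> \<ge> 0" using that assms lnneg[of \<epsilon>] by auto
    have "2 * c * sqrt (A - B * ln \<epsilon>) \<le> (A - B * ln \<epsilon>) + c\<^sup>2"
      using sum_squares_bound[of c "sqrt (A - B * ln \<epsilon>)"] nn by simp
    then show ?thesis unfolding f_def using c(1) by (simp add: field_simps power2_eq_square)
  qed
  have "(\<integral>\<^sup>+\<epsilon>\<in>{0<..\<delta>}. ennreal (sqrt (A - B * ln \<epsilon>)) \<partial>lborel)
      = (\<integral>\<^sup>+\<epsilon>\<in>{0<..<\<delta>}. ennreal (sqrt (A - B * ln \<epsilon>)) \<partial>lborel)"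
    using AE_lborel_singleton[of \<delta>]
    by (intro nn_integral_cong_AE) (auto elim!: eventually_mono simp: indicator_def)
  also have "\<dots> \<le> (\<integral>\<^sup>+\<epsilon>. ennreal (indicator {0<..<\<delta>} \<epsilon> * f \<epsilon>) \<partial>lborel)"
    using le by (intro nn_integral_mono) (auto simp: indicator_def ennreal_leI)
  also have "\<dots> = ennreal (LBINT \<epsilon>:{0<..<\<delta>}. f \<epsilon>)"
    using int(1) f0 unfolding set_integrable_def set_lebesgue_integral_def
    by (simp, intro nn_integral_eq_integral) (auto simp: indicator_def)
  also have "(LBINT \<epsilon>:{0<..<\<delta>}. f \<epsilon>) = \<delta> * c"
    using int(2) \<open>0 < \<delta>\<close> c_eq by (simp add: interval_lebesgue_integral_def ei)
  finally show ?thesis by (simp add: c_def)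
qed

text \<open>The cover bound is uniform in \<open>Q\<close>, so it passes to the supremum under the
  integral and leaves the integrand of \<open>nn_integral_sqrt_ln_le\<close>.\<close>

lemma entropy_J_le:
  assumes "0 < A" "0 \<le> B" "0 < \<delta>" "\<delta> \<le> 1"
    and cover: "\<And>Q \<epsilon>. Q \<in> fin_supp_probs \<Longrightarrow> 0 < \<epsilon> \<Longrightarrow> \<epsilon> \<le> 1 \<Longrightarrow>
      \<exists>K. finite K \<and> K \<subseteq> F \<and> F \<subseteq> (\<Union>g\<in>K. L2_cball Q g (\<epsilon> * L2norm Q C)) \<and>
        ln (2 * real (card K)) \<le> A - B * ln \<epsilon>"
  shows "entropy_J F C \<delta> \<le> ennreal (\<delta> * sqrt (A + B - B * ln \<delta>))"
proof -
  have "sqrt_ln_double (covering_number (\<epsilon> * L2norm Q C) F Q) \<le> ennreal (sqrt (A - B * ln \<epsilon>))"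
    if Q: "Q \<in> fin_supp_probs" and \<epsilon>: "0 < \<epsilon>" "\<epsilon> \<le> \<delta>" for Q \<epsilon>
  proof -
    obtain K where K: "finite K" "K \<subseteq> F" "F \<subseteq> (\<Union>g\<in>K. L2_cball Q g (\<epsilon> * L2norm Q C))"
      "ln (2 * real (card K)) \<le> A - B * ln \<epsilon>"
      using cover[OF Q \<epsilon>(1)] order_trans[OF \<epsilon>(2) \<open>\<delta> \<le> 1\<close>] by blast
    have "covering_number (\<epsilon> * L2norm Q C) F Q \<le> enat (card K)"
      unfolding covering_number_def using K by (intro INF_lower) auto
    then obtain n where n: "covering_number (\<epsilon> * L2norm Q C) F Q = enat n" "n \<le> card K"
      by (cases "covering_number (\<epsilon> * L2norm Q C) F Q") auto
    have nn: "0 \<le> A - B * ln \<epsilon>"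
      using assms \<epsilon> mult_nonneg_nonpos[of B "ln \<epsilon>"] by auto
    have "ln (2 * real n) \<le> A - B * ln \<epsilon>"
    \<comment> \<open>For \<open>n = 0\<close> the default value \<open>ln 0 = 0\<close> enters, and
      nonnegativity of the right side suffices.\<close>
    proof (cases "n = 0")
      case False
      then have "ln (2 * real n) \<le> ln (2 * real (card K))" using n by simp
      then show ?thesis using K(4) by linarith
    qed (use nn in simp)
    then show ?thesis unfolding n sqrt_ln_double_def by (simp add: ennreal_leI)
  qed
  then have "entropy_J F C \<delta> \<le> (\<integral>\<^sup>+\<epsilon>\<in>{0<..\<delta>}. ennreal (sqrt (A - B * ln \<epsilon>)) \<partial>lborel)"
    unfolding entropy_J_def
    by (intro nn_integral_mono) (auto simp: indicator_def intro!: SUP_least)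
  then show ?thesis using nn_integral_sqrt_ln_le[OF assms(1-4)] by (rule order_trans)
qed

section \<open>Finitely supported measures and square integrability\<close>

text \<open>Almost everywhere a function equals a finite combination of indicators of the support
  points. Hence every Borel function is integrable and its integral is a finite sum.\<close>

lemma fin_supp_probs_integral:
  fixes Q :: "'a::t1_space measure"
  assumes "Q \<in> fin_supp_probs"
  obtains S where "finite S" "(\<Sum>z\<in>S. measure Q {z}) = 1"
    "\<And>h::'a \<Rightarrow> real. h \<in> borel_measurable borel \<Longrightarrow> integrable Q h"
    "\<And>h::'a \<Rightarrow> real. h \<in> borel_measurable borel \<Longrightarrow> (\<integral>z. h z \<partial>Q) = (\<Sum>z\<in>S. measure Q {z} * h z)"
proof -
  obtain S where Q: "prob_space Q" "sets Q = sets borel" and S: "S \<in> sets Q" "finite S" "measure Q S = 1"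
    using assms by (auto simp: fin_supp_probs_def)
  interpret prob_space Q by fact
  have sing: "{z} \<in> sets Q" for z unfolding Q(2) by simp
  have AE: "AE z in Q. z \<in> S" using S by (simp add: prob_eq_1)
  have eq: "AE z in Q. h z = (\<Sum>s\<in>S. h s * indicator {s} z)" for h :: "'a \<Rightarrow> real"
    using AE by eventually_elim (use S(2) in \<open>simp add: indicator_def if_distrib sum.delta cong: if_cong\<close>)
  have int: "integrable Q (\<lambda>z. \<Sum>s\<in>S. h s * indicator {s} z)" for h :: "'a \<Rightarrow> real"
    using sing by (auto simp: less_top[symmetric])
  have meas: "h \<in> borel_measurable Q" if "h \<in> borel_measurable borel" for h :: "'a \<Rightarrow> real"
    using that measurable_cong_sets[OF Q(2) refl] by blast
  have mint: "(\<lambda>z. \<Sum>s\<in>S. h s * indicator {s} z) \<in> borel_measurable Q" for h :: "'a \<Rightarrow> real"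
    using int by (rule borel_measurable_integrable)
  show thesis
  proof (rule that[of S])
    show "finite S" by fact
    show "(\<Sum>z\<in>S. measure Q {z}) = 1"
      using S sing finite_measure_eq_sum_singleton[of S] by simp
    fix h :: "'a \<Rightarrow> real" assume h: "h \<in> borel_measurable borel"
    show "integrable Q h"
      using integrable_cong_AE[OF meas[OF h] mint eq] int by blast
    show "(\<integral>z. h z \<partial>Q) = (\<Sum>z\<in>S. measure Q {z} * h z)"
      using integral_cong_AE[OF meas[OF h] mint eq] sing
      by (subst (asm) Bochner_Integration.integral_sum) (auto simp: mult.commute less_top[symmetric])
  qed
qed

lemma sq_integrable_add:
  assumes "sq_integrable M f" "sq_integrable M g"
  shows "sq_integrable M (\<lambda>x. f x + g x)"
proof -
  note [measurable] = assms[unfolded sq_integrable_def, THEN conjunct1]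
  have "integrable M (\<lambda>x. 2 * (f x)\<^sup>2 + 2 * (g x)\<^sup>2)"
    using assms by (simp add: sq_integrable_def)
  then have "integrable M (\<lambda>x. (f x + g x)\<^sup>2)"
  proof (rule Bochner_Integration.integrable_bound)
    show "AE x in M. norm ((f x + g x)\<^sup>2) \<le> norm (2 * (f x)\<^sup>2 + 2 * (g x)\<^sup>2)"
    proof (rule AE_I2)
      fix x
      have "(f x + g x)\<^sup>2 \<le> 2 * (f x)\<^sup>2 + 2 * (g x)\<^sup>2"
        using sum_squares_bound[of "f x" "g x"] by (simp add: power2_sum)
      then show "norm ((f x + g x)\<^sup>2) \<le> norm (2 * (f x)\<^sup>2 + 2 * (g x)\<^sup>2)" by simp
    qed
  qed measurable
  then show ?thesis by (simp add: sq_integrable_def)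
qed

lemma sq_integrable_bounded_mult:
  assumes "f \<in> borel_measurable M" "bounded (range f)" "sq_integrable M g"
  shows "sq_integrable M (\<lambda>x. f x * g x)"
proof -
  note [measurable] = assms(1) assms(3)[unfolded sq_integrable_def, THEN conjunct1]
  obtain b where b: "\<And>x. \<bar>f x\<bar> \<le> b" using assms(2) by (auto simp: bounded_real)
  have "integrable M (\<lambda>x. b\<^sup>2 * (g x)\<^sup>2)"
    using assms by (simp add: sq_integrable_def)
  then have "integrable M (\<lambda>x. (f x * g x)\<^sup>2)"
  proof (rule Bochner_Integration.integrable_bound)
    show "AE x in M. norm ((f x * g x)\<^sup>2) \<le> norm (b\<^sup>2 * (g x)\<^sup>2)"
      using power_mono[OF b abs_ge_zero, of _ 2]
      by (intro AE_I2) (auto simp: power_mult_distrib intro!: mult_right_mono)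
  qed measurable
  then show ?thesis by (simp add: sq_integrable_def)
qed

lemma sq_integrable_sum:
  assumes "\<And>i. i \<in> A \<Longrightarrow> sq_integrable M (f i)"
  shows "sq_integrable M (\<lambda>x. \<Sum>i\<in>A. f i x)"
  using assms
proof (induction A rule: infinite_finite_induct)
  case (insert i A)
  then show ?case by (simp add: sq_integrable_add)
qed (simp_all add: sq_integrable_def)

section \<open>Pieces and envelopes of the Hoelder representation\<close>

lemma PH_f_eq:
  assumes "1 \<le> s i"
  shows "PH_f s \<Lambda> a I i \<theta> z = (if \<forall>l\<in>{1..s i}. \<Lambda> i l \<theta> z + a i l \<in> I i l then 1 else 0)"
proof -
  define h :: "nat \<Rightarrow> real" where "h l = indicator (I i l) (\<Lambda> i l \<theta> z + a i l)" for l
  have ne: "h ` {1..s i} \<noteq> {}" using assms by auto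
  have "Min (h ` {1..s i}) = (if \<forall>l\<in>{1..s i}. \<Lambda> i l \<theta> z + a i l \<in> I i l then 1 else 0)"
    using ne by (intro Min_eqI) (auto simp: h_def indicator_def image_iff Ball_def)
  then show ?thesis by (simp add: PH_f_def h_def)
qed

lemma PH_f_borel_measurable:
  assumes "\<And>l. l \<in> {1..s i} \<Longrightarrow>
    (\<lambda>(\<theta>, z). \<Lambda> i l \<theta> z) \<in> borel_measurable (borel :: ('p::second_countable_topology \<times> 'z::second_countable_topology) measure) \<and>
    I i l \<in> {{0<..}, {0..}}"
  shows "PH_f s \<Lambda> a I i \<theta> \<in> borel_measurable borel"
proof -
  have "(\<lambda>z. indicator (I i l) (\<Lambda> i l \<theta> z + a i l) :: real) \<in> borel_measurable borel"
    if "l \<in> {1..s i}" for l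
  proof -
    have [measurable]: "\<Lambda> i l \<theta> \<in> borel_measurable borel"
      using measurable_Pair2[of "\<lambda>(\<theta>, z). \<Lambda> i l \<theta> z" borel borel borel \<theta>] assms[OF that]
      by (auto simp: borel_prod)
    have "I i l = {0<..} \<or> I i l = {0..}" using assms[OF that] by blast
    then have [measurable]: "I i l \<in> sets borel" by (elim disjE) simp_all
    show ?thesis by measurable
  qed
  then show ?thesis unfolding PH_f_def[abs_def] by (intro borel_measurable_Min) auto
qed

lemma positive_envelope_abs_le:
  assumes "positive_envelope F C" "h \<in> F"
  shows "\<bar>h z\<bar> \<le> C z"
proof -
  have "ereal \<bar>h z\<bar> \<le> (SUP h\<in>F. ereal \<bar>h z\<bar>)" using assms(2) by (intro SUP_upper)
  also have "\<dots> \<le> ereal (C z)" using assms(1) by (simp add: positive_envelope_def)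
  finally show ?thesis by simp
qed

lemma affine_linear_add_const:
  assumes "affine_linear h"
  shows "affine_linear (\<lambda>x. h x + c)"
proof -
  obtain L b where "linear L" "\<And>x. h x = L x + b" using assms by (auto simp: affine_linear_def)
  then show ?thesis unfolding affine_linear_def by (intro exI[of _ L] exI[of _ "b + c"]) simp
qed

text \<open>If \<open>f\<^sup>i\<close> differs at the two parameters then one of its values is 1, so \<open>\<xi>\<^sub>i \<ge> 1\<close> there.\<close>

lemma PH_diff_le:
  fixes \<Theta> :: "(real^'m) set" and PZ :: "(real^'d) measure"
  assumes PH: "PH_representation \<Theta> PZ G r s Gi \<beta> C \<Lambda> a I"
    and env: "\<And>i. i \<in> {1..r} \<Longrightarrow> positive_envelope (PH_f s \<Lambda> a I i ` \<Theta>) (\<xi>i i)"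
    and w: "\<And>i. i \<in> {1..r} \<Longrightarrow> \<bar>Gi i \<theta> z\<bar> \<le> w i" "\<And>i. i \<in> {1..r} \<Longrightarrow> \<bar>Gi i \<theta> z - Gi i \<theta>' z\<bar> \<le> e * w i"
    and \<theta>: "\<theta> \<in> \<Theta>" "\<theta>' \<in> \<Theta>"
  shows "\<bar>G \<theta> z - G \<theta>' z\<bar> \<le>
    (of_bool (\<exists>(i, l) \<in> Sigma {1..r} (\<lambda>i. {1..s i}).
       (\<Lambda> i l \<theta> z + a i l \<in> I i l) \<noteq> (\<Lambda> i l \<theta>' z + a i l \<in> I i l)) + e) * (\<Sum>i=1..r. \<xi>i i z * w i)"
    (is "_ \<le> (of_bool ?D + e) * _")
proof -
  define f where "f i \<theta> = PH_f s \<Lambda> a I i \<theta> z" for i \<theta>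
  have f_eq: "f i \<theta> = (if \<forall>l\<in>{1..s i}. \<Lambda> i l \<theta> z + a i l \<in> I i l then 1 else 0)" if "i \<in> {1..r}" for i \<theta>
    unfolding f_def using PH that by (intro PH_f_eq) (simp add: PH_representation_def)
  have "\<bar>G \<theta> z - G \<theta>' z\<bar> = \<bar>\<Sum>i=1..r. f i \<theta> * Gi i \<theta> z - f i \<theta>' * Gi i \<theta>' z\<bar>"
    using PH \<theta> by (simp add: PH_representation_def f_def sum_subtractf)
  also have "\<dots> \<le> (\<Sum>i=1..r. \<bar>f i \<theta> * Gi i \<theta> z - f i \<theta>' * Gi i \<theta>' z\<bar>)" by (rule sum_abs)
  also have "\<dots> \<le> (\<Sum>i=1..r. (of_bool ?D + e) * (\<xi>i i z * w i))"
  proof (rule sum_mono)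
    fix i assume i: "i \<in> {1..r}"
    have fx: "\<bar>f i \<theta>\<bar> \<le> \<xi>i i z" "\<bar>f i \<theta>'\<bar> \<le> \<xi>i i z"
      using positive_envelope_abs_le[OF env[OF i]] \<theta> by (auto simp: f_def)
    have "\<bar>f i \<theta> - f i \<theta>'\<bar> \<le> of_bool ?D * \<xi>i i z"
    proof (cases "f i \<theta> = f i \<theta>'")
      case True
      then show ?thesis using fx by auto
    next
      case False
      then have "\<exists>l\<in>{1..s i}. (\<Lambda> i l \<theta> z + a i l \<in> I i l) \<noteq> (\<Lambda> i l \<theta>' z + a i l \<in> I i l)"
        using f_eq[OF i] by metis
      then have "?D" using i by auto
      moreover have "\<bar>f i \<theta> - f i \<theta>'\<bar> \<le> \<xi>i i z" using False f_eq[OF i] fx by (auto split: if_splits)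
      ultimately show ?thesis by simp
    qed
    then have 1: "\<bar>f i \<theta> - f i \<theta>'\<bar> * \<bar>Gi i \<theta> z\<bar> \<le> (of_bool ?D * \<xi>i i z) * w i"
      using fx w(1)[OF i] by (intro mult_mono) auto
    have 2: "\<bar>f i \<theta>'\<bar> * \<bar>Gi i \<theta> z - Gi i \<theta>' z\<bar> \<le> \<xi>i i z * (e * w i)"
      using fx w(2)[OF i] by (intro mult_mono) auto
    \<comment> \<open>The difference of products is split so that the jump of \<open>f\<close> meets
      the bound on \<open>Gi i \<theta>\<close> and the increment of \<open>Gi\<close> meets the
      envelope of \<open>f\<close>.\<close>
    have "\<bar>f i \<theta> * Gi i \<theta> z - f i \<theta>' * Gi i \<theta>' z\<bar>
        = \<bar>(f i \<theta> - f i \<theta>') * Gi i \<theta> z + f i \<theta>' * (Gi i \<theta> z - Gi i \<theta>' z)\<bar>"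
      by (simp add: algebra_simps)
    also have "\<dots> \<le> \<bar>f i \<theta> - f i \<theta>'\<bar> * \<bar>Gi i \<theta> z\<bar> + \<bar>f i \<theta>'\<bar> * \<bar>Gi i \<theta> z - Gi i \<theta>' z\<bar>"
      by (metis abs_mult abs_triangle_ineq)
    also have "\<dots> \<le> (of_bool ?D + e) * (\<xi>i i z * w i)"
      using 1 2 by (simp add: algebra_simps)
    finally show "\<bar>f i \<theta> * Gi i \<theta> z - f i \<theta>' * Gi i \<theta>' z\<bar> \<le> (of_bool ?D + e) * (\<xi>i i z * w i)" .
  qed
  finally show ?thesis by (simp add: sum_distrib_left)
qed

section \<open>Explicit constants and the cover of the whole family\<close>

text \<open>On the left stands A + B - B ln \<delta> with the constants that \<open>PH_cover\<close>
  yields. The 4 on the right is the square of the 2 in front of the root in the final bound.\<close>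

lemma entropy_bound_arith:
  fixes r m S p \<delta> :: real
  assumes "1 \<le> r" "1 \<le> m" "1 \<le> S" "0 \<le> p" "0 < \<delta>" "\<delta> \<le> 1"
  shows "(ln 2 + m * ln 5 + m * p * ln 2 + 2 * m * ln (16 * S) + 1/2) + (m * p + 4 * m) - (m * p + 4 * m) * ln \<delta>
    \<le> 4 * (r + 2 * r * m * ln 3 + m * ln (4 * r / \<delta>) * p + ln 2 + (5 + 2 * ln (4 * r / \<delta>)) * (m + 2) * S)"
proof -
  define L where "L = - ln \<delta>"
  define q where "q = ln (4 * r / \<delta>)"
  have L: "0 \<le> L" using assms by (simp add: L_def)
  have "ln (4::real) = 2 * ln 2" using ln_realpow[of "2::real" 2] by simp
  \<comment> \<open>Since \<open>r\<close> is at least 1 and ln 4 = 2 ln 2 >= 4/3, the quantity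
    \<open>q\<close> dominates \<open>L\<close> with room to spare.\<close>
  moreover have "ln 4 \<le> ln (4 * r)" using assms by simp
  ultimately have q: "4/3 + L \<le> q"
    using assms ln2_ge_two_thirds by (simp add: q_def L_def ln_div)
  have l2: "ln 2 \<le> (1::real)" using ln_le_minus_one[of "2::real"] by simp
  have "ln (5::real) \<le> ln (3 ^ 2)" by simp
  also have "\<dots> = 2 * ln 3" by (subst ln_realpow) auto
  finally have "m * ln 5 \<le> m * (2 * ln 3)" using assms by (intro mult_left_mono) auto
  also have "\<dots> \<le> r * (m * (2 * ln 3))" using mult_right_mono[of 1 r "m * (2 * ln 3)"] assms by simp
  finally have 1: "m * ln 5 \<le> 2 * r * m * ln 3" by (simp add: mult_ac)
  have 5: "0 \<le> 2 * r * m * ln 3" using assms by simp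
  have 2: "m * p * (ln 2 + 1 + L) \<le> m * p * (4 * q)"
    using q L l2 assms by (intro mult_left_mono) auto
  have "ln (16::real) = 4 * ln 2" using ln_realpow[of "2::real" 4] by simp
  \<comment> \<open>The estimate ln S <= S - 1 makes this term linear in \<open>S\<close>, so that
    the last summand of the target can absorb it.\<close>
  then have "ln (16 * S) \<le> 4 * 1 + (S - 1)"
    using assms ln_le_minus_one[of S] l2 by (simp add: ln_mult)
  then have "2 * m * ln (16 * S) \<le> 2 * m * (4 * 1 + (S - 1))" using assms by (intro mult_left_mono) auto
  also have "\<dots> = 6 * m + 2 * (m * S)" by (simp add: algebra_simps)
  finally have "2 * m * ln (16 * S) \<le> 6 * m + 2 * (m * S)" .
  moreover have "m * 1 \<le> m * S" using assms by (intro mult_left_mono) auto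
  moreover have "m * L * 1 \<le> (m * q) * S" using assms q L by (intro mult_mono) auto
  moreover have "0 \<le> q * S" "0 \<le> m * L" using assms q L by simp_all
  moreover have "4 * ((5 + 2 * q) * (m + 2) * S) = 20 * (m * S) + 40 * S + 8 * (m * q * S) + 16 * (q * S)"
    by (simp add: algebra_simps)
  ultimately have 3: "2 * m * ln (16 * S) + 1/2 + 4 * m + 4 * (m * L) \<le> 4 * ((5 + 2 * q) * (m + 2) * S)"
    using assms by linarith
  have 4: "ln 2 \<le> 4 * (r + ln (2::real))" using assms ln2_ge_two_thirds by simp
  show ?thesis unfolding q_def[symmetric] using 1 2 3 4 5 by (simp add: L_def algebra_simps)
qed

text \<open>Reweighting \<open>Q\<close> by \<open>\<xi>\<^sup>2\<close> turns the \<open>L\<^sup>2(Q)\<close> distance caused by differing sign patterns into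
  \<open>\<parallel>\<xi>\<parallel>\<close> times the square root of the probability that the patterns differ.\<close>

lemma PH_cover:
  fixes \<Theta> :: "(real^'m) set" and PZ :: "(real^'d) measure"
  assumes \<Theta>: "\<Theta> \<noteq> {}" "compact \<Theta>" "0 < diameter \<Theta>"
    and PZ: "sets PZ = sets borel"
    and PH: "PH_representation \<Theta> PZ G r s Gi \<beta> C \<Lambda> a I"
    and \<theta>b: "\<theta>b \<in> \<Theta>"
    and env: "\<And>i. i \<in> {1..r} \<Longrightarrow> positive_envelope (PH_f s \<Lambda> a I i ` \<Theta>) (\<xi>i i)"
    and G_meas: "\<And>\<theta>. \<theta> \<in> \<Theta> \<Longrightarrow> G \<theta> \<in> borel_measurable borel"
    and Q: "Q \<in> fin_supp_probs" and \<epsilon>: "0 < \<epsilon>" "\<epsilon> \<le> 1"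
  defines "\<xi> \<equiv> \<lambda>z. \<Sum>i=1..r. \<xi>i i z * (diameter \<Theta> powr \<beta> i * C i z + \<bar>Gi i \<theta>b z\<bar>)"
    and "m \<equiv> real CARD('m)" and "p \<equiv> \<Sum>i=1..r. 1 / \<beta> i" and "S \<equiv> \<Sum>i=1..r. real (s i)"
  shows "\<exists>K. finite K \<and> K \<subseteq> G ` \<Theta> \<and> G ` \<Theta> \<subseteq> (\<Union>g\<in>K. L2_cball Q g (\<epsilon> * L2norm Q \<xi>)) \<and>
    ln (2 * real (card K)) \<le>
      (ln 2 + m * ln 5 + m * p * ln 2 + 2 * m * ln (16 * S) + 1/2) - (m * p + 4 * m) * ln \<epsilon>"
proof -
  define \<Delta> where "\<Delta> = diameter \<Theta>"
  define w where "w i z = \<Delta> powr \<beta> i * C i z + \<bar>Gi i \<theta>b z\<bar>" for i z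
  define e where "e = \<epsilon> / 2"
  define t where "t = e powr p"
  define J where "J = Sigma {1..r} (\<lambda>i. {1..s i})"
  have \<xi>_eq: "\<xi> = (\<lambda>z. \<Sum>i=1..r. \<xi>i i z * w i z)" by (simp add: \<xi>_def w_def \<Delta>_def)
  have r: "1 \<le> r" and s: "\<And>i. i \<in> {1..r} \<Longrightarrow> 1 \<le> s i"
    and \<beta>: "\<And>i. i \<in> {1..r} \<Longrightarrow> 0 < \<beta> i" "\<And>i. i \<in> {1..r} \<Longrightarrow> \<beta> i \<le> 1"
    and C: "\<And>i z. i \<in> {1..r} \<Longrightarrow> 0 < C i z" "\<And>i. i \<in> {1..r} \<Longrightarrow> C i \<in> borel_measurable borel"
    and Gi: "\<And>i \<theta>. i \<in> {1..r} \<Longrightarrow> \<theta> \<in> \<Theta> \<Longrightarrow> Gi i \<theta> \<in> borel_measurable borel"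
    and holder: "\<And>i z \<theta> \<theta>'. i \<in> {1..r} \<Longrightarrow> \<theta> \<in> \<Theta> \<Longrightarrow> \<theta>' \<in> \<Theta> \<Longrightarrow>
      \<bar>Gi i \<theta> z - Gi i \<theta>' z\<bar> \<le> C i z * dist \<theta> \<theta>' powr \<beta> i"
    and \<Lambda>: "\<And>i l z. i \<in> {1..r} \<Longrightarrow> l \<in> {1..s i} \<Longrightarrow> affine_linear (\<lambda>\<theta>. \<Lambda> i l \<theta> z)"
    and I: "\<And>i l. i \<in> {1..r} \<Longrightarrow> l \<in> {1..s i} \<Longrightarrow> I i l \<in> {{0<..}, {0..}}"
    using PH measurable_cong_sets[OF PZ refl, of "borel :: real measure"]
    unfolding PH_representation_def sq_integrable_def by auto
  have \<xi>i: "\<And>i z. i \<in> {1..r} \<Longrightarrow> 0 < \<xi>i i z" "\<And>i. i \<in> {1..r} \<Longrightarrow> \<xi>i i \<in> borel_measurable borel"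
    using env by (auto simp: positive_envelope_def)
  have \<Delta>: "0 < \<Delta>" using \<Theta> by (simp add: \<Delta>_def)
  have bdd: "bounded \<Theta>" using \<Theta> compact_imp_bounded by blast
  have w0: "0 < w i z" if "i \<in> {1..r}" for i z
    using C(1)[OF that, of z] \<Delta> by (simp add: w_def add_pos_nonneg)
  have \<xi>0: "0 < \<xi> z" for z
    unfolding \<xi>_eq using r \<xi>i(1) w0 by (intro sum_pos) auto
  have [measurable]: "\<xi> \<in> borel_measurable borel"
    unfolding \<xi>_def using \<xi>i(2) C(2) Gi \<theta>b
    by (intro borel_measurable_sum borel_measurable_times borel_measurable_add borel_measurable_abs) auto
  have e: "0 < e" "e \<le> 1/2" using \<epsilon> by (auto simp: e_def)
  have p: "0 \<le> p" unfolding p_def using \<beta> by (intro sum_nonneg) (simp add: less_imp_le)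
  have t: "0 < t" "t \<le> 1" using e p by (auto simp: t_def intro: powr_le1)
  have t_\<beta>: "t powr \<beta> i \<le> e" if i: "i \<in> {1..r}" for i
  proof -
    have "1 / \<beta> i \<le> p" unfolding p_def
      using i \<beta> by (intro member_le_sum) (auto simp: less_imp_le)
    then have "1 \<le> p * \<beta> i" using \<beta>(1)[OF i] by (simp add: field_simps)
    then have "e powr (p * \<beta> i) \<le> e powr 1" using e by (intro powr_mono') auto
    then show ?thesis using e by (simp add: t_def powr_powr)
  qed
  obtain Z where Z: "finite Z" "(\<Sum>z\<in>Z. measure Q {z}) = 1"
    "\<And>h::real^'d \<Rightarrow> real. h \<in> borel_measurable borel \<Longrightarrow> integrable Q h"
    "\<And>h::real^'d \<Rightarrow> real. h \<in> borel_measurable borel \<Longrightarrow> (\<integral>z. h z \<partial>Q) = (\<Sum>z\<in>Z. measure Q {z} * h z)"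
    using fin_supp_probs_integral[OF Q] by blast
  define W where "W = (\<Sum>z\<in>Z. measure Q {z} * (\<xi> z)\<^sup>2)"
  obtain z where "z \<in> Z" "measure Q {z} \<noteq> 0" using Z(2) by (metis sum.neutral zero_neq_one)
  then have W: "0 < W"
    unfolding W_def using Z(1) \<xi>0[of z] by (intro sum_pos2[of Z z]) (auto simp: zero_less_measure_iff)
  define u where "u z = measure Q {z} * (\<xi> z)\<^sup>2 / W" for z
  have u: "\<And>z. 0 \<le> u z" "sum u Z = 1"
    using W by (auto simp: u_def W_def sum_divide_distrib[symmetric])
  have "(1, 1) \<in> J" using r s[of 1] by (simp add: J_def)
  then have "J \<noteq> {}" by blast
  moreover have "finite J" by (simp add: J_def)
  ultimately have J: "finite J" "J \<noteq> {}" by blast+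
  have cJ: "real (card J) = S" by (simp add: J_def S_def)
  have S: "1 \<le> S" using J cJ by (metis One_nat_def Suc_leI card_gt_0_iff of_nat_1 of_nat_le_iff)
  \<comment> \<open>Flattening the index pairs lets one net control the sign conditions of all
    pieces together; the number of affine functions per point is then \<open>S\<close>.\<close>
  define g where "g = (\<lambda>(i, l) z \<theta>. \<Lambda> i l \<theta> z + a i l)"
  define D where "D \<theta> \<theta>' z \<longleftrightarrow> (\<exists>j\<in>J. (g j z \<theta> \<in> case_prod I j) \<noteq> (g j z \<theta>' \<in> case_prod I j))" for \<theta> \<theta>' z
  have e2: "0 < e\<^sup>2" "e\<^sup>2 \<le> 1" using e by (auto simp: power_le_one)
  have aff: "affine_linear (g j z) \<and> case_prod I j \<in> {{0<..}, {0..}}" if "j \<in> J" for j z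
  proof -
    obtain i l where "j = (i, l)" "i \<in> {1..r}" "l \<in> {1..s i}" using \<open>j \<in> J\<close> by (auto simp: J_def)
    then show ?thesis using \<Lambda>[of i l] I[of i l] by (simp add: g_def affine_linear_add_const)
  qed
  obtain K where K: "finite K" "K \<subseteq> \<Theta>"
      "real (card K) \<le> (5 / t) ^ CARD('m) * (exp (1/2) * (4 * S / e\<^sup>2) ^ (2 * CARD('m)))"
      "\<And>\<theta>. \<theta> \<in> \<Theta> \<Longrightarrow> \<exists>\<theta>'\<in>K. dist \<theta> \<theta>' \<le> \<Delta> * t \<and> (\<Sum>z | z \<in> Z \<and> D \<theta> \<theta>' z. u z) < e\<^sup>2"
    using sign_pattern_net[where g = g and I = "case_prod I", OF J aff Z(1) u e2 t bdd \<Theta>(3)]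
    unfolding D_def \<Delta>_def by (auto simp: cJ)
  have close: "G \<theta> \<in> L2_cball Q (G \<theta>') (\<epsilon> * L2norm Q \<xi>)"
    if \<theta>: "\<theta> \<in> \<Theta>" "\<theta>' \<in> \<Theta>" and d: "dist \<theta> \<theta>' \<le> \<Delta> * t" and sm: "(\<Sum>z | z \<in> Z \<and> D \<theta> \<theta>' z. u z) < e\<^sup>2" for \<theta> \<theta>'
  proof -
    have pw: "\<bar>G \<theta> z - G \<theta>' z\<bar> \<le> (of_bool (D \<theta> \<theta>' z) + e) * \<xi> z" for z
    proof -
      have "\<bar>Gi i \<theta> z\<bar> \<le> w i z" if i: "i \<in> {1..r}" for i
      proof -
        have "\<bar>Gi i \<theta> z - Gi i \<theta>b z\<bar> \<le> C i z * dist \<theta> \<theta>b powr \<beta> i" using holder i \<theta> \<theta>b by blast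
        also have "dist \<theta> \<theta>b powr \<beta> i \<le> \<Delta> powr \<beta> i" unfolding \<Delta>_def
          using \<beta>(1)[OF i] by (intro powr_mono2 diameter_bounded_bound bdd \<theta> \<theta>b) auto
        finally show ?thesis using C(1)[OF i, of z] by (simp add: w_def mult.commute)
      qed
      moreover have "\<bar>Gi i \<theta> z - Gi i \<theta>' z\<bar> \<le> e * w i z" if i: "i \<in> {1..r}" for i
      proof -
        have "dist \<theta> \<theta>' powr \<beta> i \<le> (\<Delta> * t) powr \<beta> i"
          using \<beta>(1)[OF i] d by (intro powr_mono2) auto
        also have "\<dots> = \<Delta> powr \<beta> i * t powr \<beta> i" using \<Delta> t by (simp add: powr_mult)
        also have "\<dots> \<le> \<Delta> powr \<beta> i * e" using t_\<beta>[OF i] by (intro mult_left_mono) auto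
        finally have "C i z * dist \<theta> \<theta>' powr \<beta> i \<le> C i z * (\<Delta> powr \<beta> i * e)"
          using C(1)[OF i, of z] by (intro mult_left_mono) auto
        also have "\<dots> \<le> e * w i z" using e by (simp add: w_def algebra_simps)
        finally show ?thesis using holder[OF i \<theta>, of z] by linarith
      qed
      ultimately show ?thesis
        using PH_diff_le[OF PH env, of \<theta> z "\<lambda>i. w i z" \<theta>' e] \<theta>
        by (auto simp: \<xi>_eq D_def J_def g_def split_def)
    qed
    have hm: "(\<lambda>z. G \<theta> z - G \<theta>' z) \<in> borel_measurable borel" using G_meas \<theta> by simp
    have "(\<integral>z. (G \<theta> z - G \<theta>' z)\<^sup>2 \<partial>Q) = (\<Sum>z\<in>Z. measure Q {z} * (G \<theta> z - G \<theta>' z)\<^sup>2)"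
      by (intro Z(4) borel_measurable_power hm)
    also have "\<dots> \<le> (\<Sum>z\<in>Z. measure Q {z} * ((of_bool (D \<theta> \<theta>' z) + e) * \<xi> z)\<^sup>2)"
      using power_mono[OF pw abs_ge_zero, of _ 2] by (intro sum_mono mult_left_mono) simp_all
    \<comment> \<open>With 1 the indicator value on \<open>D\<close>, (1 + e)^2 = (1 + 2e) + e^2, so
      the exceptional set contributes only its \<open>u\<close>-mass, which is below e^2. Together
      with e <= 1/2 the total stays within 4 e^2 = \<epsilon>^2.\<close>
    also have "\<dots> = (\<Sum>z\<in>Z. W * ((1 + 2 * e) * (if D \<theta> \<theta>' z then u z else 0) + e\<^sup>2 * u z))"
      using W by (intro sum.cong) (auto simp: u_def field_simps power2_eq_square)
    also have "\<dots> = W * ((1 + 2 * e) * (\<Sum>z | z \<in> Z \<and> D \<theta> \<theta>' z. u z) + e\<^sup>2)"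
      using Z(1) u(2)
      by (simp add: sum.inter_filter sum.distrib flip: sum_distrib_left)
    also have "\<dots> \<le> W * ((1 + 2 * e) * e\<^sup>2 + e\<^sup>2)"
      using W e sm by (intro mult_left_mono add_right_mono) auto
    also have "\<dots> = W * ((2 + 2 * e) * e\<^sup>2)" by (simp add: algebra_simps)
    also have "\<dots> \<le> W * (4 * e\<^sup>2)"
      using W e by (intro mult_left_mono mult_right_mono) auto
    also have "\<dots> = \<epsilon>\<^sup>2 * W" by (simp add: e_def power2_eq_square)
    also have "W = (\<integral>z. (\<xi> z)\<^sup>2 \<partial>Q)" unfolding W_def by (intro Z(4)[symmetric]) measurable
    finally have "L2norm Q (\<lambda>z. G \<theta> z - G \<theta>' z) \<le> sqrt (\<epsilon>\<^sup>2 * (\<integral>z. (\<xi> z)\<^sup>2 \<partial>Q))"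
      unfolding L2norm_def by simp
    also have "\<dots> = \<epsilon> * L2norm Q \<xi>" using \<epsilon> by (simp add: L2norm_def real_sqrt_mult)
    finally have "L2norm Q (\<lambda>z. G \<theta> z - G \<theta>' z) \<le> \<epsilon> * L2norm Q \<xi>" .
    moreover have "sets Q = sets borel" using Q by (simp add: fin_supp_probs_def)
    then have "(\<lambda>z. G \<theta> z - G \<theta>' z) \<in> borel_measurable Q"
      using hm by (simp cong: measurable_cong_sets)
    then have "sq_integrable Q (\<lambda>z. G \<theta> z - G \<theta>' z)"
      using Z(3)[OF borel_measurable_power[OF hm]] by (simp add: sq_integrable_def)
    ultimately show ?thesis by (simp add: L2_cball_def)
  qed
  have "K \<noteq> {}" using K(4) \<theta>b by blast
  then have c0: "0 < card (G ` K)" using K(1) by (simp add: card_gt_0_iff)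
  have "ln (2 * real (card (G ` K)))
      \<le> ln (2 * ((5 / t) ^ CARD('m) * (exp (1/2) * (4 * S / e\<^sup>2) ^ (2 * CARD('m)))))"
    using c0 K(3) card_image_le[OF K(1), of G] by (subst ln_le_cancel_iff) auto
  \<comment> \<open>The factor ln(5/t) contributes -p ln \<epsilon> and the last logarithm -2 ln
    \<epsilon>, whence the coefficient m p + 4 m.\<close>
  also have "\<dots> = ln 2 + m * ln (5 / t) + 1/2 + 2 * m * ln (4 * S / e\<^sup>2)"
    using t S e by (simp add: ln_mult ln_realpow m_def)
  also have "ln (5 / t) = ln 5 - p * (ln \<epsilon> - ln 2)"
    using t e \<epsilon> by (simp add: ln_div t_def e_def ln_powr)
  also have "4 * S / e\<^sup>2 = 16 * S / \<epsilon>\<^sup>2" by (simp add: e_def power2_eq_square)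
  also have "ln (16 * S / \<epsilon>\<^sup>2) = ln (16 * S) - 2 * ln \<epsilon>"
    using S \<epsilon> by (simp add: ln_div ln_realpow)
  finally have "ln (2 * real (card (G ` K))) \<le>
      (ln 2 + m * ln 5 + m * p * ln 2 + 2 * m * ln (16 * S) + 1/2) - (m * p + 4 * m) * ln \<epsilon>"
    by (simp add: algebra_simps)
  moreover have "G ` \<Theta> \<subseteq> (\<Union>g\<in>G ` K. L2_cball Q g (\<epsilon> * L2norm Q \<xi>))"
  proof
    fix h assume "h \<in> G ` \<Theta>"
    then obtain \<theta> where "\<theta> \<in> \<Theta>" "h = G \<theta>" by blast
    obtain \<theta>' where "\<theta>' \<in> K" "dist \<theta> \<theta>' \<le> \<Delta> * t" "(\<Sum>z | z \<in> Z \<and> D \<theta> \<theta>' z. u z) < e\<^sup>2"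
      using K(4)[OF \<open>\<theta> \<in> \<Theta>\<close>] by blast
    then have "h \<in> L2_cball Q (G \<theta>') (\<epsilon> * L2norm Q \<xi>)"
      using close[of \<theta> \<theta>'] \<open>\<theta> \<in> \<Theta>\<close> \<open>h = G \<theta>\<close> K(2) by (simp add: subsetD)
    then show "h \<in> (\<Union>g\<in>G ` K. L2_cball Q g (\<epsilon> * L2norm Q \<xi>))"
      using \<open>\<theta>' \<in> K\<close> by blast
  qed
  ultimately show ?thesis using K(1,2) by (intro exI[of _ "G ` K"] conjI image_mono) simp_all
qed

section \<open>Measurability, envelope and entropy bound combined\<close>

theorem proposition2p8:
  fixes \<Theta> :: "(real^'m) set"
    and PZ :: "(real^'d) measure"
    and G :: "real^'m \<Rightarrow> real^'d \<Rightarrow> real"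
    and r :: nat
    and s :: "nat \<Rightarrow> nat"
    and Gi :: "nat \<Rightarrow> real^'m \<Rightarrow> real^'d \<Rightarrow> real"
    and \<beta> :: "nat \<Rightarrow> real"
    and C :: "nat \<Rightarrow> real^'d \<Rightarrow> real"
    and \<Lambda> :: "nat \<Rightarrow> nat \<Rightarrow> real^'m \<Rightarrow> real^'d \<Rightarrow> real"
    and a :: "nat \<Rightarrow> nat \<Rightarrow> real"
    and I :: "nat \<Rightarrow> nat \<Rightarrow> real set"
  assumes "\<Theta> \<noteq> {}" and "compact \<Theta>"
    and "prob_space PZ" and "sets PZ = sets borel"
    and "PH_representation \<Theta> PZ G r s Gi \<beta> C \<Lambda> a I"
  shows "(\<forall>\<theta>\<in>\<Theta>. \<forall>i\<in>{1..r}. PH_f s \<Lambda> a I i \<theta> \<in> borel_measurable borel \<and>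
            Gi i \<theta> \<in> borel_measurable borel) \<and>
    (\<forall>\<theta>\<in>\<Theta>. G \<theta> \<in> borel_measurable borel) \<and>
    (\<forall>\<theta>b \<xi>i.
       0 < diameter \<Theta> \<longrightarrow>
       \<theta>b \<in> \<Theta> \<longrightarrow>
       (\<forall>i\<in>{1..r}. sq_integrable PZ (Gi i \<theta>b)) \<longrightarrow>
       (\<forall>i\<in>{1..r}. positive_envelope (PH_f s \<Lambda> a I i ` \<Theta>) (\<xi>i i) \<and> bounded (range (\<xi>i i))) \<longrightarrow>
       (let \<xi> = (\<lambda>z. \<Sum>i=1..r. \<xi>i i z * (diameter \<Theta> powr \<beta> i * C i z + \<bar>Gi i \<theta>b z\<bar>)) in
          sq_integrable PZ \<xi> \<and>
          (\<forall>z. 0 < \<xi> z) \<and>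
          (\<forall>z. (SUP \<theta>\<in>\<Theta>. ereal \<bar>G \<theta> z\<bar>) \<le> ereal (\<xi> z)) \<and>
          (\<forall>\<delta>\<in>{0<..1}.
             entropy_J (G ` \<Theta>) \<xi> \<delta> \<le> ennreal (2 * \<delta> * sqrt (
               real r + 2 * real r * real CARD('m) * ln 3
               + real CARD('m) * ln (4 * real r / \<delta>) * (\<Sum>i=1..r. 1 / \<beta> i)
               + ln 2
               + (5 + 2 * ln (4 * real r / \<delta>)) * (real CARD('m) + 2) * (\<Sum>i=1..r. real (s i)))))))"
proof -
  note PH = assms(5)
  have r: "1 \<le> r" and s: "\<And>i. i \<in> {1..r} \<Longrightarrow> 1 \<le> s i"
    and G_eq: "\<And>\<theta> z. \<theta> \<in> \<Theta> \<Longrightarrow> G \<theta> z = (\<Sum>i=1..r. PH_f s \<Lambda> a I i \<theta> z * Gi i \<theta> z)"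
    and \<beta>: "\<And>i. i \<in> {1..r} \<Longrightarrow> 0 < \<beta> i"
    and C: "\<And>i z. i \<in> {1..r} \<Longrightarrow> 0 < C i z" "\<And>i. i \<in> {1..r} \<Longrightarrow> sq_integrable PZ (C i)"
    and Gi: "\<And>i \<theta>. i \<in> {1..r} \<Longrightarrow> \<theta> \<in> \<Theta> \<Longrightarrow> Gi i \<theta> \<in> borel_measurable borel"
    and holder: "\<And>i z \<theta> \<theta>'. i \<in> {1..r} \<Longrightarrow> \<theta> \<in> \<Theta> \<Longrightarrow> \<theta>' \<in> \<Theta> \<Longrightarrow>
      \<bar>Gi i \<theta> z - Gi i \<theta>' z\<bar> \<le> C i z * dist \<theta> \<theta>' powr \<beta> i"
    using PH unfolding PH_representation_def by auto
  have f_meas: "PH_f s \<Lambda> a I i \<theta> \<in> borel_measurable borel" if "i \<in> {1..r}" for i \<theta>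
    using PH that by (intro PH_f_borel_measurable) (auto simp: PH_representation_def)
  have G_meas: "G \<theta> \<in> borel_measurable borel" if "\<theta> \<in> \<Theta>" for \<theta>
  proof -
    have "(\<lambda>z. \<Sum>i=1..r. PH_f s \<Lambda> a I i \<theta> z * Gi i \<theta> z) \<in> borel_measurable borel"
      using f_meas Gi that by (intro borel_measurable_sum borel_measurable_times) auto
    then show ?thesis using G_eq[OF that] by (simp add: fun_eq_iff[symmetric] cong: measurable_cong)
  qed
  have main: "sq_integrable PZ \<xi> \<and> (\<forall>z. 0 < \<xi> z) \<and> (\<forall>z. (SUP \<theta>\<in>\<Theta>. ereal \<bar>G \<theta> z\<bar>) \<le> ereal (\<xi> z)) \<and>
      (\<forall>\<delta>\<in>{0<..1}. entropy_J (G ` \<Theta>) \<xi> \<delta> \<le> ennreal (2 * \<delta> * sqrt (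
               real r + 2 * real r * real CARD('m) * ln 3
               + real CARD('m) * ln (4 * real r / \<delta>) * (\<Sum>i=1..r. 1 / \<beta> i)
               + ln 2
               + (5 + 2 * ln (4 * real r / \<delta>)) * (real CARD('m) + 2) * (\<Sum>i=1..r. real (s i)))))"
    if diam: "0 < diameter \<Theta>" and \<theta>b: "\<theta>b \<in> \<Theta>"
      and sq: "\<forall>i\<in>{1..r}. sq_integrable PZ (Gi i \<theta>b)"
      and env: "\<forall>i\<in>{1..r}. positive_envelope (PH_f s \<Lambda> a I i ` \<Theta>) (\<xi>i i) \<and> bounded (range (\<xi>i i))"
      and \<xi>_def: "\<xi> = (\<lambda>z. \<Sum>i=1..r. \<xi>i i z * (diameter \<Theta> powr \<beta> i * C i z + \<bar>Gi i \<theta>b z\<bar>))"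
    for \<theta>b \<xi>i \<xi>
  proof (intro conjI ballI allI)
    have env': "\<And>i. i \<in> {1..r} \<Longrightarrow> positive_envelope (PH_f s \<Lambda> a I i ` \<Theta>) (\<xi>i i)" using env by blast
    have bdd: "bounded \<Theta>" using assms(2) by (rule compact_imp_bounded)
    show "sq_integrable PZ \<xi>" unfolding \<xi>_def
    proof (rule sq_integrable_sum)
      fix i assume i: "i \<in> {1..r}"
      have "sq_integrable PZ (\<lambda>z. diameter \<Theta> powr \<beta> i * C i z)"
        using C(2)[OF i] by (intro sq_integrable_bounded_mult) auto
      moreover have "sq_integrable PZ (\<lambda>z. \<bar>Gi i \<theta>b z\<bar>)"
        using sq i by (auto simp: sq_integrable_def intro: borel_measurable_abs)
      moreover have "\<xi>i i \<in> borel_measurable PZ"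
        using env'[OF i] measurable_cong_sets[OF assms(4) refl, of "borel :: real measure"] by (auto simp: positive_envelope_def)
      ultimately show "sq_integrable PZ (\<lambda>z. \<xi>i i z * (diameter \<Theta> powr \<beta> i * C i z + \<bar>Gi i \<theta>b z\<bar>))"
        using env i by (intro sq_integrable_bounded_mult[of "\<xi>i i"] sq_integrable_add) auto
    qed
    show "0 < \<xi> z" for z
      unfolding \<xi>_def using r diam C(1) env'
      by (intro sum_pos mult_pos_pos add_pos_nonneg) (auto simp: positive_envelope_def)
    show "(SUP \<theta>\<in>\<Theta>. ereal \<bar>G \<theta> z\<bar>) \<le> ereal (\<xi> z)" for z
    proof (rule SUP_least)
      fix \<theta> assume \<theta>: "\<theta> \<in> \<Theta>"
      have "\<bar>G \<theta> z\<bar> \<le> (\<Sum>i=1..r. \<bar>PH_f s \<Lambda> a I i \<theta> z * Gi i \<theta> z\<bar>)"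
        unfolding G_eq[OF \<theta>] by (rule sum_abs)
      also have "\<dots> \<le> \<xi> z" unfolding \<xi>_def abs_mult
      proof (rule sum_mono, rule mult_mono)
        fix i assume i: "i \<in> {1..r}"
        show "\<bar>PH_f s \<Lambda> a I i \<theta> z\<bar> \<le> \<xi>i i z"
          using positive_envelope_abs_le[OF env'[OF i]] \<theta> by blast
        then show "0 \<le> \<xi>i i z" by linarith
        \<comment> \<open>Comparison with the reference parameter: the distance to it is at most the
          diameter, so the Hoelder condition bounds \<open>Gi\<close> uniformly in \<theta>.\<close>
        have "\<bar>Gi i \<theta> z - Gi i \<theta>b z\<bar> \<le> C i z * dist \<theta> \<theta>b powr \<beta> i" using holder i \<theta> \<theta>b by blast
        also have "dist \<theta> \<theta>b powr \<beta> i \<le> diameter \<Theta> powr \<beta> i"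
          using \<beta>[OF i] by (intro powr_mono2 diameter_bounded_bound bdd \<theta> \<theta>b) auto
        finally show "\<bar>Gi i \<theta> z\<bar> \<le> diameter \<Theta> powr \<beta> i * C i z + \<bar>Gi i \<theta>b z\<bar>"
          using C(1)[OF i, of z] by (simp add: mult.commute)
      qed simp
      finally show "ereal \<bar>G \<theta> z\<bar> \<le> ereal (\<xi> z)" by simp
    qed
    fix \<delta> :: real assume "\<delta> \<in> {0<..1}"
    then have \<delta>: "0 < \<delta>" "\<delta> \<le> 1" by auto
    define m p S where "m = real CARD('m)" and "p = (\<Sum>i=1..r. 1 / \<beta> i)" and "S = (\<Sum>i=1..r. real (s i))"
    have m: "1 \<le> m" by (simp add: m_def Suc_leI)
    have p: "0 \<le> p" unfolding p_def using \<beta> by (intro sum_nonneg) (simp add: less_imp_le)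
    have "real (s 1) \<le> S" unfolding S_def using r by (intro member_le_sum) auto
    then have S: "1 \<le> S" using s[of 1] r by simp
    \<comment> \<open>\<open>A\<close> and \<open>B\<close> are the constants in the logarithmic
      cover bound of \<open>PH_cover\<close>, while \<open>T\<close> is the radicand of the
      claim.\<close>
    define A where "A = ln 2 + m * ln 5 + m * p * ln 2 + 2 * m * ln (16 * S) + 1/2"
    define B where "B = m * p + 4 * m"
    define T where "T = real r + 2 * real r * m * ln 3 + m * ln (4 * real r / \<delta>) * p + ln 2
      + (5 + 2 * ln (4 * real r / \<delta>)) * (m + 2) * S"
    have A: "0 < A" using m p S by (auto simp: A_def intro!: add_nonneg_pos add_nonneg_nonneg)
    have B: "0 \<le> B" using m p by (simp add: B_def)
    have "entropy_J (G ` \<Theta>) \<xi> \<delta> \<le> ennreal (\<delta> * sqrt (A + B - B * ln \<delta>))"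
      using PH_cover[OF assms(1,2) diam assms(4) PH \<theta>b env' G_meas] A B \<delta>
      unfolding A_def B_def m_def p_def S_def \<xi>_def
      by (intro entropy_J_le) auto
    also have "A + B - B * ln \<delta> \<le> 4 * T"
      unfolding A_def B_def T_def using m p S r \<delta> by (intro entropy_bound_arith) auto
    then have "\<delta> * sqrt (A + B - B * ln \<delta>) \<le> \<delta> * sqrt (4 * T)" using \<delta> by simp
    also have "\<dots> = 2 * \<delta> * sqrt T" by (simp add: real_sqrt_mult)
    finally show "entropy_J (G ` \<Theta>) \<xi> \<delta> \<le> ennreal (2 * \<delta> * sqrt (
               real r + 2 * real r * real CARD('m) * ln 3
               + real CARD('m) * ln (4 * real r / \<delta>) * (\<Sum>i=1..r. 1 / \<beta> i)
               + ln 2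
               + (5 + 2 * ln (4 * real r / \<delta>)) * (real CARD('m) + 2) * (\<Sum>i=1..r. real (s i))))"
      unfolding T_def m_def p_def S_def by (auto intro: ennreal_leI order_trans)
  qed
  show ?thesis using f_meas Gi G_meas main by (simp add: Let_def)
qed

end
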